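(* Let $X\ge0$ be a random variable with continuous cdf $F$, and let $X_1,X_2,\dots$ be i.i.d. copies of $X$. Assume that $\mathbb E|X|^{2+\delta}<+\infty$ for some $\delta>0$. Let $$\sigma_F^2=\int_0^\infty\left[\int_0^yF(x)\,\omega\big(F(x)\big)\,dx\right]\big(1-F(y)\big)\,\omega\big(F(y)\big)\,dy$$ and let its empirical counterpart be $$\sigma_n^2=\int_0^\infty\left[\int_0^yF_n(x)\,\omega_n\big(F_n(x)\big)\,dx\right]\big(1-F_n(y)\big)\,\omega_n\big(F_n(y)\big)\,dy .$$ Then, almost surely, $\sigma_n^2\to\sigma_F^2$ as $n\to\infty$.
   Context: Quantile function: $F^{-1}(p)=\inf\{x:F(x)\ge p\}$; $L(p)=\int_0^pF^{-1}(s)\,ds$ and $M(p)=\int_{1-p}^1F^{-1}(s)\,ds$ for $p\in[0,1]$. Empirical versions: $F_n(x)=\frac1n\sum_{i=1}^n\mathbf 1_{[0,x]}(X_i)$, $F_n^{-1}(s)=\inf\{x:F_n(x)\ge s\}$, $L_n(p)=\int_0^pF_n^{-1}(s)\,ds$, $M_n(p)=\int_{1-p}^1F_n^{-1}(s)\,ds$. Weight functions: $\omega(t)=\omega_1(t)+\omega_2(t)$ with $$\omega_1(t)=\int_t^1\frac1{M(s)}\,ds,\qquad\omega_2(t)=\int_0^t\frac{L(1-s)}{[M(1-s)]^2}\,ds,$$ and the empirical weight $\omega_n(t)=\omega_{1,n}(t)+\omega_{2,n}(t)$ with $$\omega_{1,n}(t)=\int_t^1\frac1{M_n(s)}\,ds,\qquad\omega_{2,n}(t)=\int_0^t\frac{L_n(1-s)}{[M_n(1-s)]^2}\,ds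 .$$ *)

theory Defs
  imports "HOL-Probability.Probability"
begin

text \<open>
  The functionals below take a cumulative distribution function \<open>G\<close> of a law on the half-line
  \<open>[0, \<infinity>)\<close>.  Applied to the population cdf \<open>F\<close> and to the empirical cdf they give the population
  quantities and their empirical counterparts.

  All integrands are nonnegative, so integrals are taken in \<open>[0, \<infinity>]\<close>.  The weight
  may be infinite at \<open>0\<close> and at \<open>1\<close>; it occurs only in \<open>G x * \<omega> (G x)\<close> and
  \<open>(1 - G y) * \<omega> (G y)\<close>, where the usual convention \<open>0 * \<infinity> = 0\<close> (which is that of
  \<^typ>\<open>ennreal\<close>) applies.
\<close>

text \<open>
  For \<open>0 < p < 1\<close> the infimum is over a nonempty set that is bounded below by \<open>0\<close>.  The values at
  \<open>p = 0\<close> and \<open>p = 1\<close> may be unspecified, but only integrals of the quantile function are used.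
\<close>

definition quantile :: "(real \<Rightarrow> real) \<Rightarrow> real \<Rightarrow> real" where
  "quantile G p = Inf {x. G x \<ge> p}"

definition lower_L :: "(real \<Rightarrow> real) \<Rightarrow> real \<Rightarrow> ennreal" where
  "lower_L G p = (\<integral>\<^sup>+s\<in>{0..p}. ennreal (quantile G s) \<partial>lborel)"

definition upper_M :: "(real \<Rightarrow> real) \<Rightarrow> real \<Rightarrow> ennreal" where
  "upper_M G p = (\<integral>\<^sup>+s\<in>{1 - p..1}. ennreal (quantile G s) \<partial>lborel)"

definition weight1 :: "(real \<Rightarrow> real) \<Rightarrow> real \<Rightarrow> ennreal" where
  "weight1 G t = (\<integral>\<^sup>+s\<in>{t..1}. 1 / upper_M G s \<partial>lborel)"

definition weight2 :: "(real \<Rightarrow> real) \<Rightarrow> real \<Rightarrow> ennreal" where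
  "weight2 G t = (\<integral>\<^sup>+s\<in>{0..t}. lower_L G (1 - s) / (upper_M G (1 - s))\<^sup>2 \<partial>lborel)"

definition weight :: "(real \<Rightarrow> real) \<Rightarrow> real \<Rightarrow> ennreal" where
  "weight G t = weight1 G t + weight2 G t"

definition sigma_sq :: "(real \<Rightarrow> real) \<Rightarrow> ennreal" where
  "sigma_sq G =
    (\<integral>\<^sup>+y\<in>{0..}.
        (\<integral>\<^sup>+x\<in>{0..y}. ennreal (G x) * weight G (G x) \<partial>lborel)
        * (ennreal (1 - G y) * weight G (G y)) \<partial>lborel)"

text \<open>The empirical cdf of the first \<open>n\<close> members \<open>X 0, \<dots>, X (n - 1)\<close> of a sample.\<close>

definition empirical_cdf :: "(nat \<Rightarrow> real) \<Rightarrow> nat \<Rightarrow> real \<Rightarrow> real" where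
  "empirical_cdf X n x = (1 / real n) * (\<Sum>i<n. indicator {0..x} (X i))"

end

theory Submission
  imports Defs
begin

text \<open>
  The almost sure statement reduces to a deterministic one.  Suppose that distribution functions
  \<open>Gs n\<close> on the half-line converge pointwise to \<open>G\<close>, that \<open>1 - Gs n y \<le> K * y powr - q\<close> for some
  \<open>q > 2\<close> and \<open>K\<close> independent of \<open>n\<close>, and that \<open>G\<close> is not concentrated at \<open>0\<close>.  Then
  \<open>sigma_sq (Gs n)\<close> tends to the finite number \<open>sigma_sq G\<close>
  (\<open>sigma_sq_tendsto_of_power_tail\<close>).

  The deterministic part is a chain of dominated convergences.  The tail bound dominates all quantile
  functions by a multiple of \<open>1 / sqrt (1 - s)\<close>; since they converge at all but countably many
  points, \<open>lower_L\<close> and \<open>upper_M\<close> converge.  The uniform inequalities \<open>upper_M G s \<ge> const * s\<close> and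
  \<open>lower_L G s \<le> const * s\<close> then show that the weights converge on the open unit interval and have
  at most logarithmic singularities at its ends.  Write \<open>sigma_sq G\<close> as a double integral over
  \<open>0 \<le> x \<le> y\<close> of the product of \<open>G x * weight G (G x)\<close> and \<open>(1 - G y) * weight G (G y)\<close>.  Because
  \<open>x \<le> y\<close>, the factors \<open>G x\<close> and \<open>1 - G y\<close> absorb all four singularities
  (\<open>weight_pair_le\<close>), and the product is at most a multiple of \<open>(1 - G y) powr (1 - 2 * \<eta>)\<close> for a
  small \<open>\<eta>\<close>.  With \<open>q > 2\<close> this leaves an integrable majorant that does not depend on \<open>n\<close>.

  The probabilistic part supplies the hypotheses for the empirical distribution functions on a set
  of full measure.  Pointwise convergence follows from Hoeffding's inequality, first at the rationals
  and then everywhere by monotonicity and continuity of \<open>F\<close>.  By Markov's inequality for the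
  empirical measure, a common tail bound holds once the averages of the variables
  \<open>\<bar>Xs i\<bar> powr (2 + \<delta> / 2)\<close> are bounded in \<open>n\<close>.  These variables have a moment of order
  larger than \<open>1\<close>, so truncation, Chebyshev's inequality and the Borel--Cantelli lemma along powers
  of \<open>2\<close> give the bound (\<open>AE_indep_sums_linearly_bounded\<close>).
\<close>

section \<open>Integration preliminaries\<close>

lemma borel_measurable_mono_ennreal:
  fixes f :: "real \<Rightarrow> ennreal"
  assumes "mono f"
  shows "f \<in> borel_measurable borel"
proof (rule borel_measurableI_ge)
  fix y
  have "mono (\<lambda>x. if y \<le> f x then 1 else (0::real))"
    using assms by (auto simp: mono_def intro: order_trans)
  then have [measurable]: "(\<lambda>x. if y \<le> f x then 1 else (0::real)) \<in> borel_measurable borel"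
    by (rule borel_measurable_mono)
  have "{x \<in> space borel. y \<le> f x} = {x \<in> space borel. (if y \<le> f x then 1 else (0::real)) = 1}"
    by auto
  also have "\<dots> \<in> sets borel" by measurable
  finally show "{x \<in> space borel. y \<le> f x} \<in> sets borel" .
qed

lemma borel_measurable_antimono_ennreal:
  fixes f :: "real \<Rightarrow> ennreal"
  assumes "antimono f"
  shows "f \<in> borel_measurable borel"
proof -
  have "mono (\<lambda>x. f (- x))" using assms by (auto simp: mono_def antimono_def)
  then have [measurable]: "(\<lambda>x. f (- x)) \<in> borel_measurable borel"
    by (rule borel_measurable_mono_ennreal)
  have "(\<lambda>x. (\<lambda>x. f (- x)) (- x)) \<in> borel_measurable borel" by measurable
  then show ?thesis by simp
qed

lemma nn_integral_dominated_convergence_eventually: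
  fixes u :: "nat \<Rightarrow> 'a \<Rightarrow> ennreal"
  assumes meas: "\<And>i. u i \<in> borel_measurable M" "u' \<in> borel_measurable M" "w \<in> borel_measurable M"
    and bound: "\<forall>\<^sub>F j in sequentially. AE x in M. u j x \<le> w x"
    and w: "(\<integral>\<^sup>+x. w x \<partial>M) < \<infinity>"
    and lim: "AE x in M. (\<lambda>i. u i x) \<longlonglongrightarrow> u' x"
  shows "(\<lambda>i. (\<integral>\<^sup>+x. u i x \<partial>M)) \<longlonglongrightarrow> (\<integral>\<^sup>+x. u' x \<partial>M)"
proof -
  obtain N where N: "\<And>j. j \<ge> N \<Longrightarrow> AE x in M. u j x \<le> w x"
    using bound by (auto simp: eventually_sequentially)
  have "(\<lambda>i. (\<integral>\<^sup>+x. u (i + N) x \<partial>M)) \<longlonglongrightarrow> (\<integral>\<^sup>+x. u' x \<partial>M)"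
  proof (rule nn_integral_dominated_convergence[where w = w])
    show "AE x in M. (\<lambda>i. u (i + N) x) \<longlonglongrightarrow> u' x"
      using lim by eventually_elim (rule LIMSEQ_ignore_initial_segment)
  qed (use meas w N in auto)
  then show ?thesis by (rule LIMSEQ_offset)
qed

lemma inverse_antimono_ennreal: "x \<le> y \<Longrightarrow> inverse y \<le> inverse x" for x y :: ennreal
  by (simp add: less_eq_ennreal.rep_eq inverse_ennreal.rep_eq ereal_inverse_antimono)

lemma eventually_le_limit_iff:
  fixes a :: "nat \<Rightarrow> real"
  assumes "a \<longlonglongrightarrow> a'" "s \<noteq> a'"
  shows "\<forall>\<^sub>F n in sequentially. a n \<le> s \<longleftrightarrow> a' \<le> s"
proof (cases "a' < s")
  case True
  show ?thesis using order_tendstoD(2)[OF assms(1) True] by eventually_elim (use True in auto)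
next
  case False
  then have "s < a'" using assms(2) by simp
  show ?thesis using order_tendstoD(1)[OF assms(1) \<open>s < a'\<close>]
    by eventually_elim (use \<open>s < a'\<close> in auto)
qed

lemma nn_integral_inverse_sqrt:
  assumes "0 \<le> p" "p \<le> 1" "0 \<le> K"
  shows "(\<integral>\<^sup>+s\<in>{0..p}. ennreal (K / sqrt (1 - s)) \<partial>lborel) = ennreal (2 * K * (1 - sqrt (1 - p)))"
proof -
  have "((\<lambda>s. K / sqrt (1 - s)) has_integral
      (- 2 * K * sqrt (1 - p)) - (- 2 * K * sqrt (1 - 0))) {0..p}"
    using assms
    by (intro fundamental_theorem_of_calculus_interior)
       (auto intro!: continuous_intros derivative_eq_intros
         simp: has_real_derivative_iff_has_vector_derivative[symmetric] divide_simps)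
  then have "((\<lambda>s. K / sqrt (1 - s)) has_integral 2 * K * (1 - sqrt (1 - p))) {0..p}"
    by (simp add: algebra_simps)
  then show ?thesis
    using assms by (intro nn_integral_has_integral_lebesgue') auto
qed

lemma nn_integral_reciprocal:
  assumes "0 < t" "t \<le> 1" "0 \<le> c"
  shows "(\<integral>\<^sup>+s\<in>{t..1}. ennreal (c / s) \<partial>lborel) = ennreal (c * ln (1 / t))"
proof -
  have "((\<lambda>s. c / s) has_integral c * ln 1 - c * ln t) {t..1}"
    using assms
    by (intro fundamental_theorem_of_calculus)
       (auto intro!: derivative_eq_intros
         simp: has_real_derivative_iff_has_vector_derivative[symmetric])
  then have "((\<lambda>s. c / s) has_integral c * ln (1 / t)) {t..1}"
    using assms by (simp add: ln_div)
  then show ?thesis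
    using assms by (intro nn_integral_has_integral_lebesgue') auto
qed

lemma nn_integral_reciprocal_reflected:
  assumes "0 \<le> t" "t < 1" "0 \<le> c"
  shows "(\<integral>\<^sup>+s\<in>{0..t}. ennreal (c / (1 - s)) \<partial>lborel) = ennreal (c * ln (1 / (1 - t)))"
proof -
  have "((\<lambda>s. c / (1 - s)) has_integral - c * ln (1 - t) - - c * ln (1 - 0)) {0..t}"
    using assms
    by (intro fundamental_theorem_of_calculus)
       (auto intro!: derivative_eq_intros
         simp: has_real_derivative_iff_has_vector_derivative[symmetric])
  then have "((\<lambda>s. c / (1 - s)) has_integral c * ln (1 / (1 - t))) {0..t}"
    using assms by (simp add: ln_div)
  then show ?thesis
    using assms by (intro nn_integral_has_integral_lebesgue') auto
qed

section \<open>Quantiles and weights under a power tail\<close>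

text \<open>
  Each of the four functionals integrates a nonnegative function over an interval that grows or
  shrinks with the parameter, so it is monotone in the parameter and hence measurable.
\<close>
lemma mono_lower_L: "mono (lower_L G)"
  unfolding lower_L_def
  by (intro monoI nn_integral_mono) (auto simp: indicator_def)

lemma mono_upper_M: "mono (upper_M G)"
  unfolding upper_M_def
  by (intro monoI nn_integral_mono) (auto simp: indicator_def)

lemma antimono_weight1: "antimono (weight1 G)"
  unfolding weight1_def
  by (intro antimonoI nn_integral_mono) (auto simp: indicator_def)

lemma mono_weight2: "mono (weight2 G)"
  unfolding weight2_def
  by (intro monoI nn_integral_mono) (auto simp: indicator_def)

lemmas [measurable] =
  borel_measurable_mono_ennreal[OF mono_lower_L] borel_measurable_mono_ennreal[OF mono_upper_M]
  borel_measurable_antimono_ennreal[OF antimono_weight1]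
  borel_measurable_mono_ennreal[OF mono_weight2]

lemma measurable_weight [measurable]: "weight G \<in> borel_measurable borel"
  unfolding weight_def[abs_def] by measurable

text \<open>
  All estimates are uniform over the functions \<open>G\<close> that satisfy these conditions with fixed
  parameters.  The tail exponent \<open>q > 2\<close> controls the upper end of the quantile function, and the
  condition \<open>G x\<^sub>0 \<le> c < 1\<close> with \<open>x\<^sub>0 > 0\<close> is a quantitative form of not being concentrated at
  \<open>0\<close>: it keeps \<open>upper_M G s\<close> above a fixed multiple of \<open>s\<close>.
\<close>
locale power_tail_cdf =
  fixes q K x\<^sub>0 c :: real and G :: "real \<Rightarrow> real"
  assumes q: "2 < q" and K: "1 \<le> K" and mono: "mono G"
    and zero: "\<And>x. x < 0 \<Longrightarrow> G x = 0" and le1: "\<And>x. G x \<le> 1"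
    and tail: "\<And>y. 0 < y \<Longrightarrow> 1 - G y \<le> K * y powr - q"
    and x\<^sub>0: "0 < x\<^sub>0" and c: "0 \<le> c" "c < 1" and G_x\<^sub>0: "G x\<^sub>0 \<le> c"
begin

lemma nonneg: "0 \<le> G x"
  using zero[of "min x (-1)"] monoD[OF mono, of "min x (-1)" x] by simp

lemma measurable_G [measurable]: "G \<in> borel_measurable borel"
  using mono by (rule borel_measurable_mono)

lemma quantile_le:
  assumes "0 < s" "s \<le> G x"
  shows "quantile G s \<le> x"
  unfolding quantile_def
proof (rule cInf_lower)
  show "bdd_below {x. s \<le> G x}"
    by (rule bdd_belowI[of _ 0]) (use assms zero in \<open>force simp: not_less[symmetric]\<close>)
qed (use assms in auto)

text \<open>
  Since \<open>q \<ge> 2\<close> and \<open>K \<ge> 1\<close>, the tail at \<open>y = K / sqrt (1 - s)\<close> is at most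
  \<open>K * y powr - 2 = (1 - s) / K\<close>.  So the quantile function is dominated by a multiple of
  \<open>1 / sqrt (1 - s)\<close>, which is integrable up to \<open>1\<close>.
\<close>
lemma level_reached:
  assumes "s < 1"
  shows "s \<le> G (K / sqrt (1 - s))"
proof (cases "s \<le> 0")
  case True
  then show ?thesis using nonneg[of "K / sqrt (1 - s)"] by simp
next
  case False
  define y where "y = K / sqrt (1 - s)"
  have y1: "1 \<le> y" using False assms K
    by (auto simp: y_def divide_simps intro: order_trans[OF _ K])
  have "K * y powr - q \<le> K * y powr - 2"
    using y1 K q by (intro mult_left_mono powr_mono) auto
  also have "y powr - 2 = 1 / y ^ 2"
    using y1 by (simp add: powr_minus_divide)
  also have "K * (1 / y ^ 2) = (1 - s) / K"
    using assms K by (simp add: y_def power_divide power2_eq_square divide_simps)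
  also have "\<dots> \<le> 1 - s"
    using assms K by (simp add: divide_simps)
  finally show ?thesis using tail[of y] y1 by (simp add: y_def)
qed

lemma quantile_ge:
  assumes "G x < s" "s < 1"
  shows "x \<le> quantile G s"
  unfolding quantile_def
proof (rule cInf_greatest)
  show "{x. s \<le> G x} \<noteq> {}" using level_reached[OF assms(2)] by auto
  show "x \<le> y" if "y \<in> {x. s \<le> G x}" for y
    using that assms monoD[OF mono, of y x] by (cases "x \<le> y") auto
qed

lemma quantile_mono: "mono_on {0<..<1} (quantile G)"
proof (rule mono_onI)
  fix r s :: real assume *: "r \<in> {0<..<1}" "s \<in> {0<..<1}" "r \<le> s"
  show "quantile G r \<le> quantile G s"
    unfolding quantile_def
  proof (rule cInf_superset_mono)
    show "{x. s \<le> G x} \<noteq> {}" using level_reached[of s] * by auto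
    show "bdd_below {x. r \<le> G x}"
      by (rule bdd_belowI[of _ 0]) (use * zero in \<open>force simp: not_less[symmetric]\<close>)
  qed (use * in auto)
qed

lemma quantile_le_tail:
  assumes "0 < s" "s < 1"
  shows "quantile G s \<le> K / sqrt (1 - s)"
  using assms level_reached by (intro quantile_le)

lemma measurable_quantile:
  "(\<lambda>s. ennreal (quantile G s) * indicator {0<..<1} s) \<in> borel_measurable lborel"
proof -
  have "quantile G \<in> borel_measurable (restrict_space borel {0<..<1})"
    by (rule borel_measurable_mono_on_fnc[OF quantile_mono])
  then have "(\<lambda>s. quantile G s * indicator {0<..<1} s) \<in> borel_measurable borel"
    by (subst (asm) borel_measurable_restrict_space_iff) (auto simp: mult.commute)
  then have "(\<lambda>s. ennreal (quantile G s * indicator {0<..<1} s)) \<in> borel_measurable lborel"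
    by measurable
  also have "(\<lambda>s. ennreal (quantile G s * indicator {0<..<1} s)) =
      (\<lambda>s. ennreal (quantile G s) * indicator {0<..<1} s)"
    by (auto simp: indicator_def)
  finally show ?thesis .
qed

lemma lower_L_le_total:
  assumes "0 \<le> p" "p \<le> 1"
  shows "lower_L G p \<le> ennreal (2 * K * (1 - sqrt (1 - p)))"
proof -
  have "lower_L G p \<le> (\<integral>\<^sup>+s\<in>{0..p}. ennreal (K / sqrt (1 - s)) \<partial>lborel)"
    unfolding lower_L_def
  proof (rule nn_integral_mono_AE)
    show "AE s in lborel. ennreal (quantile G s) * indicator {0..p} s
        \<le> ennreal (K / sqrt (1 - s)) * indicator {0..p} s"
      using AE_lborel_singleton[of 0] AE_lborel_singleton[of 1]
      by eventually_elim
         (use assms in \<open>auto simp: indicator_def intro!: ennreal_leI quantile_le_tail\<close>)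
  qed
  then show ?thesis using nn_integral_inverse_sqrt[OF assms, of K] K by simp
qed

text \<open>
  The linear bound near \<open>p = 0\<close> compensates one of the two factors \<open>upper_M\<close> in the denominator
  of \<open>weight2\<close>, so that the integrand there is only of order \<open>1 / (1 - s)\<close>.
\<close>
lemma lower_L_le:
  assumes "0 \<le> p" "p \<le> 1"
  shows "lower_L G p \<le> ennreal (2 * K * p)"
proof -
  have "1 - p \<le> sqrt (1 - p)"
    using assms by (intro real_le_rsqrt) (auto simp: power2_eq_square algebra_simps mult_left_le)
  then have "2 * K * (1 - sqrt (1 - p)) \<le> 2 * K * p"
    using K by (intro mult_left_mono) auto
  then show ?thesis
    using lower_L_le_total[OF assms] by (meson ennreal_leI order_trans)
qed

definition M_slope :: real where "M_slope = x\<^sub>0 * (1 - c)"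

lemma M_slope_pos: "0 < M_slope" using x\<^sub>0 c by (simp add: M_slope_def)

text \<open>
  The quantile function is at least \<open>x\<^sub>0\<close> on \<open>{c<..<1}\<close>, and this interval meets \<open>{1 - s..1}\<close>
  in length at least \<open>(1 - c) * s\<close>.
\<close>
lemma upper_M_ge:
  assumes "0 \<le> s" "s \<le> 1"
  shows "ennreal (M_slope * s) \<le> upper_M G s"
proof -
  let ?a = "max (1 - s) c"
  have "s * (1 - c) \<le> 1 - c" using assms c by (intro mult_left_le_one_le) auto
  moreover have "s * (1 - c) \<le> s" using assms c by (intro mult_left_le) auto
  ultimately have "s * (1 - c) \<le> 1 - ?a" by simp
  then have "x\<^sub>0 * (s * (1 - c)) \<le> x\<^sub>0 * (1 - ?a)"
    using x\<^sub>0 by (intro mult_left_mono) auto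
  then have "ennreal (M_slope * s) \<le> ennreal (x\<^sub>0 * (1 - ?a))"
    by (intro ennreal_leI) (simp add: M_slope_def mult_ac)
  also have "\<dots> = (\<integral>\<^sup>+s\<in>{?a<..<1}. ennreal x\<^sub>0 \<partial>lborel)"
    using assms c x\<^sub>0 by (simp add: nn_integral_cmult_indicator ennreal_mult)
  also have "\<dots> \<le> upper_M G s"
    unfolding upper_M_def
  proof (rule nn_integral_mono)
    fix r
    show "ennreal x\<^sub>0 * indicator {?a<..<1} r \<le> ennreal (quantile G r) * indicator {1 - s..1} r"
      using G_x\<^sub>0 by (auto simp: indicator_def intro!: ennreal_leI quantile_ge)
  qed
  finally show ?thesis .
qed

lemma inverse_upper_M_le:
  assumes "0 < s" "s \<le> 1"
  shows "1 / upper_M G s \<le> ennreal (1 / M_slope / s)"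
proof -
  have ms: "0 < M_slope * s" using M_slope_pos assms by simp
  have "1 / upper_M G s \<le> 1 / ennreal (M_slope * s)"
    unfolding divide_ennreal_def using assms
    by (intro mult_left_mono inverse_antimono_ennreal upper_M_ge) auto
  also have "\<dots> = ennreal (1 / (M_slope * s))"
    using ms by (simp flip: ennreal_1 add: divide_ennreal)
  finally show ?thesis by simp
qed

lemma weight1_le:
  assumes "0 < t" "t \<le> 1"
  shows "weight1 G t \<le> ennreal (1 / M_slope * ln (1 / t))"
proof -
  have "weight1 G t \<le> (\<integral>\<^sup>+s\<in>{t..1}. ennreal (1 / M_slope / s) \<partial>lborel)"
    unfolding weight1_def
    by (intro nn_integral_mono) (use assms inverse_upper_M_le in \<open>auto simp: indicator_def\<close>)
  then show ?thesis using nn_integral_reciprocal[OF assms, of "1 / M_slope"] M_slope_pos by simp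
qed

lemma weight2_integrand_le:
  assumes "0 \<le> s" "s < 1"
  shows "lower_L G (1 - s) / (upper_M G (1 - s))\<^sup>2 \<le> ennreal (2 * K / M_slope\<^sup>2 / (1 - s))"
proof -
  let ?r = "1 - s"
  have r: "0 < ?r" "?r \<le> 1" using assms by auto
  have "lower_L G ?r / (upper_M G ?r)\<^sup>2 \<le> ennreal (2 * K * ?r) / (ennreal (M_slope * ?r))\<^sup>2"
    unfolding divide_ennreal_def using r
    by (intro mult_mono inverse_antimono_ennreal power_mono upper_M_ge lower_L_le) auto
  also have "\<dots> = ennreal ((2 * K * ?r) / (M_slope * ?r)\<^sup>2)"
    using r M_slope_pos K by (subst ennreal_power) (auto simp: divide_ennreal)
  also have "(2 * K * ?r) / (M_slope * ?r)\<^sup>2 = 2 * K / M_slope\<^sup>2 / ?r"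
    using r M_slope_pos by (simp add: power2_eq_square divide_simps)
  finally show ?thesis .
qed

lemma weight2_le:
  assumes "0 \<le> t" "t < 1"
  shows "weight2 G t \<le> ennreal (2 * K / M_slope\<^sup>2 * ln (1 / (1 - t)))"
proof -
  have "weight2 G t \<le> (\<integral>\<^sup>+s\<in>{0..t}. ennreal (2 * K / M_slope\<^sup>2 / (1 - s)) \<partial>lborel)"
    unfolding weight2_def
    by (intro nn_integral_mono) (use assms weight2_integrand_le in \<open>auto simp: indicator_def\<close>)
  then show ?thesis using nn_integral_reciprocal_reflected[OF assms, of "2 * K / M_slope\<^sup>2"] K by simp
qed

text \<open>
  The logarithms in the bounds of the weights are replaced by powers of this small order.  It is
  chosen so that \<open>(1 - G y) powr (1 - 2 * \<eta>)\<close> still decays faster than \<open>y powr - 2\<close>.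
\<close>
definition \<eta> :: real where "\<eta> = (q - 2) / (4 * q)"

lemma \<eta>: "0 < \<eta>" "\<eta> < 1 / 4" "q * (1 - 2 * \<eta>) = q / 2 + 1"
  using q by (auto simp: \<eta>_def field_simps)

definition weight_const :: real where "weight_const = (1 / M_slope + 2 * K / M_slope\<^sup>2) / \<eta>"

lemma weight_const_pos: "0 < weight_const"
  using M_slope_pos K \<eta> by (auto simp: weight_const_def intro!: divide_pos_pos add_pos_nonneg)

lemma weight_le:
  assumes "0 < t" "t < 1"
  shows "weight G t \<le> ennreal (weight_const * (t powr - \<eta> + (1 - t) powr - \<eta>))"
proof -
  have lg: "ln (1 / r) \<le> r powr - \<eta> / \<eta>" if "0 < r" "r < 1" for r
    using ln_powr_bound[of "1 / r" \<eta>] that \<eta>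
    by (simp add: powr_minus_divide powr_divide)
  have n1: "0 \<le> ln (1 / t)" "0 \<le> ln (1 / (1 - t))" using assms by (auto intro!: ln_ge_zero)
  have "weight G t \<le> ennreal (1 / M_slope * ln (1 / t)) + ennreal (2 * K / M_slope\<^sup>2 * ln (1 / (1 - t)))"
    unfolding weight_def using assms by (intro add_mono weight1_le weight2_le) auto
  also have "\<dots> = ennreal (1 / M_slope * ln (1 / t) + 2 * K / M_slope\<^sup>2 * ln (1 / (1 - t)))"
    using n1 M_slope_pos K by (intro ennreal_plus[symmetric] mult_nonneg_nonneg) auto
  also have "\<dots> \<le> ennreal (weight_const * (t powr - \<eta> + (1 - t) powr - \<eta>))"
  proof (rule ennreal_leI)
    have "1 / M_slope * ln (1 / t) \<le> 1 / M_slope * (t powr - \<eta> / \<eta>)"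
      using assms M_slope_pos by (intro mult_left_mono lg) auto
    moreover have "2 * K / M_slope\<^sup>2 * ln (1 / (1 - t)) \<le> 2 * K / M_slope\<^sup>2 * ((1 - t) powr - \<eta> / \<eta>)"
      using assms K by (intro mult_left_mono lg) auto
    moreover have "0 \<le> 1 / M_slope * ((1 - t) powr - \<eta> / \<eta>)" "0 \<le> 2 * K / M_slope\<^sup>2 * (t powr - \<eta> / \<eta>)"
      using M_slope_pos K \<eta> by auto
    moreover have "weight_const * (t powr - \<eta> + (1 - t) powr - \<eta>) =
      1 / M_slope * (t powr - \<eta> / \<eta>) + 2 * K / M_slope\<^sup>2 * ((1 - t) powr - \<eta> / \<eta>)
      + 1 / M_slope * ((1 - t) powr - \<eta> / \<eta>) + 2 * K / M_slope\<^sup>2 * (t powr - \<eta> / \<eta>)"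
      unfolding weight_const_def using \<eta>(1) by (simp add: algebra_simps add_divide_distrib)
    ultimately show "1 / M_slope * ln (1 / t) + 2 * K / M_slope\<^sup>2 * ln (1 / (1 - t))
        \<le> weight_const * (t powr - \<eta> + (1 - t) powr - \<eta>)" by linarith
  qed
  finally show ?thesis .
qed

lemma weight_finite: "0 < t \<Longrightarrow> t < 1 \<Longrightarrow> weight G t < \<infinity>"
  using weight_le[of t] by (metis ennreal_less_top infinity_ennreal_def le_less_trans)

text \<open>
  The weight is singular at both ends, but only \<open>t \<le> u\<close> occurs.  Then each of
  \<open>t powr - \<eta>\<close>, \<open>u powr - \<eta>\<close>, \<open>(1 - t) powr - \<eta>\<close>, \<open>(1 - u) powr - \<eta>\<close> is at most
  \<open>t powr - \<eta> * (1 - u) powr - \<eta>\<close>, and the prefactors \<open>t\<close> and \<open>1 - u\<close> absorb the square of this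
  product.  The right-hand side vanishes at \<open>t = 0\<close> and at \<open>u = 1\<close>, which settles the points
  where the weight is infinite.
\<close>
lemma weight_pair_le:
  assumes "0 \<le> t" "t \<le> u" "u \<le> 1"
  shows "ennreal t * weight G t * (ennreal (1 - u) * weight G u)
    \<le> ennreal (4 * weight_const\<^sup>2 * t powr (1 - 2 * \<eta>) * (1 - u) powr (1 - 2 * \<eta>))"
proof (cases "0 < t \<and> u < 1")
  case False
  then have "t = 0 \<or> u = 1" using assms by auto
  then show ?thesis by auto
next
  case True
  then have b: "0 < t" "t < 1" "0 < u" "u < 1" using assms by auto
  define a where "a = t powr - \<eta>"
  define b where "b = (1 - u) powr - \<eta>"
  have ge1: "1 \<le> r powr - \<eta>" if "0 < r" "r \<le> 1" for r
    using that \<eta> powr_mono'[of "-\<eta>" 0 r] by simp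
  have a1: "1 \<le> a" "1 \<le> b" using b ge1 by (auto simp: a_def b_def)
  have "(1 - t) powr - \<eta> \<le> b" "u powr - \<eta> \<le> a"
    unfolding a_def b_def using b assms \<eta> by (auto intro!: powr_mono2')
  moreover have "a \<le> a * b" "b \<le> a * b" using a1 by auto
  ultimately have w: "t powr - \<eta> + (1 - t) powr - \<eta> \<le> 2 * (a * b)"
    "u powr - \<eta> + (1 - u) powr - \<eta> \<le> 2 * (a * b)"
    unfolding a_def[symmetric] b_def[symmetric] by linarith+
  have W: "weight G r \<le> ennreal (weight_const * (2 * (a * b)))"
    if "r powr - \<eta> + (1 - r) powr - \<eta> \<le> 2 * (a * b)" "0 < r" "r < 1" for r
    using weight_le[OF that(2,3)] that(1) weight_const_pos
    by (meson ennreal_leI mult_left_mono less_imp_le order_trans)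
  have "ennreal t * weight G t * (ennreal (1 - u) * weight G u)
      \<le> ennreal t * ennreal (weight_const * (2 * (a * b))) * (ennreal (1 - u) * ennreal (weight_const * (2 * (a * b))))"
    using W[OF w(1)] W[OF w(2)] b by (intro mult_mono) auto
  also have "\<dots> = ennreal (t * (weight_const * (2 * (a * b))) * ((1 - u) * (weight_const * (2 * (a * b)))))"
    using b weight_const_pos a1 by (subst ennreal_mult[symmetric]; simp)+
  also have "t * (weight_const * (2 * (a * b))) * ((1 - u) * (weight_const * (2 * (a * b)))) =
      4 * weight_const\<^sup>2 * (t * (a * a)) * ((1 - u) * (b * b))"
    by (simp add: power2_eq_square algebra_simps)
  also have "t * (a * a) = t powr (1 - 2 * \<eta>)"
    using b powr_add[of t 1 "- \<eta> + - \<eta>"] by (simp add: a_def flip: powr_add)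
  also have "(1 - u) * (b * b) = (1 - u) powr (1 - 2 * \<eta>)"
    using b powr_add[of "1 - u" 1 "- \<eta> + - \<eta>"] by (simp add: b_def flip: powr_add)
  finally show ?thesis .
qed

lemma pair_kernel_le:
  assumes "x \<le> y"
  shows "ennreal (G x) * weight G (G x) * (ennreal (1 - G y) * weight G (G y))
    \<le> ennreal (4 * weight_const\<^sup>2 * G x powr (1 - 2 * \<eta>) * (1 - G y) powr (1 - 2 * \<eta>))"
  using nonneg monoD[OF mono assms] le1 by (rule weight_pair_le)

lemma pair_kernel_le_tail:
  assumes "x \<le> y"
  shows "ennreal (G x) * weight G (G x) * (ennreal (1 - G y) * weight G (G y))
    \<le> ennreal (4 * weight_const\<^sup>2 * (1 - G y) powr (1 - 2 * \<eta>))"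
proof -
  have "G x powr (1 - 2 * \<eta>) \<le> 1"
    using nonneg le1 \<eta> by (intro powr_le1) auto
  then have "4 * weight_const\<^sup>2 * G x powr (1 - 2 * \<eta>) * (1 - G y) powr (1 - 2 * \<eta>)
      \<le> 4 * weight_const\<^sup>2 * 1 * (1 - G y) powr (1 - 2 * \<eta>)"
    by (intro mult_right_mono mult_left_mono) auto
  then show ?thesis
    by (intro order_trans[OF pair_kernel_le[OF assms]] ennreal_leI) (simp only: mult_1_right)
qed

text \<open>
  The inner integral costs a factor \<open>y\<close>.  Up to constants, the result is at most \<open>1\<close> for
  \<open>y \<le> 1\<close>, and for \<open>y \<ge> 1\<close> the tail gives
  \<open>y * (y powr - q) powr (1 - 2 * \<eta>) = y powr (- q / 2)\<close>, where \<open>- q / 2 < - 1\<close>.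
\<close>
lemma inner_integral_le:
  "(\<integral>\<^sup>+x\<in>{0..y}. ennreal (G x) * weight G (G x) * (ennreal (1 - G y) * weight G (G y)) \<partial>lborel)
    * indicator {0..} y
    \<le> ennreal (4 * weight_const\<^sup>2 * K powr (1 - 2 * \<eta>)) * (indicator {0..1} y + ennreal (y powr (- q / 2)) * indicator {1..} y)"
  (is "?I * _ \<le> _")
proof (cases "0 \<le> y")
  case False
  then show ?thesis by simp
next
  case True
  let ?r = "1 - 2 * \<eta>"
  have "?I \<le> (\<integral>\<^sup>+x\<in>{0..y}. ennreal (4 * weight_const\<^sup>2 * (1 - G y) powr ?r) \<partial>lborel)"
  proof (rule nn_integral_mono)
    fix x
    show "ennreal (G x) * weight G (G x) * (ennreal (1 - G y) * weight G (G y)) * indicator {0..y} x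
        \<le> ennreal (4 * weight_const\<^sup>2 * (1 - G y) powr ?r) * indicator {0..y} x"
      using pair_kernel_le_tail[of x y]
      by (cases "x \<in> {0..y}") (simp_all only: indicator_simps mult_1_right mult_zero_right
          order_refl atLeastAtMost_iff simp_thms)
  qed
  also have "\<dots> = ennreal (4 * weight_const\<^sup>2 * ((1 - G y) powr ?r * y))"
    using True by (simp add: nn_integral_cmult_indicator mult.assoc flip: ennreal_mult)
  also have "\<dots> \<le> ennreal (4 * weight_const\<^sup>2 * (K powr ?r * (if y < 1 then 1 else y powr (- q / 2))))"
  proof (intro ennreal_leI mult_left_mono)
    show "(1 - G y) powr ?r * y \<le> K powr ?r * (if y < 1 then 1 else y powr (- q / 2))"
    proof (cases "y < 1")
      case y1: True
      have "(1 - G y) powr ?r * y \<le> 1"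
        using nonneg le1 \<eta> y1 True by (intro mult_le_one powr_le1) auto
      also have "1 \<le> K powr ?r" using K \<eta> by (simp add: ge_one_powr_ge_zero)
      finally show ?thesis using y1 by simp
    next
      case False
      then have "(1 - G y) powr ?r * y \<le> (K * y powr - q) powr ?r * y"
        using tail[of y] le1[of y] \<eta> by (intro mult_right_mono powr_mono2) auto
      also have "\<dots> = K powr ?r * (y powr (- (q * ?r)) * y powr 1)"
        using K False by (simp add: powr_mult powr_powr)
      also have "y powr (- (q * ?r)) * y powr 1 = y powr (- q / 2)"
        unfolding \<eta>(3) powr_add[symmetric] by simp
      finally show ?thesis using False by simp
    qed
  qed auto
  also have "\<dots> = ennreal (4 * weight_const\<^sup>2 * K powr ?r) * ennreal (if y < 1 then 1 else y powr (- q / 2))"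
    by (subst ennreal_mult[symmetric]) (auto simp: mult.assoc)
  also have "\<dots> \<le> ennreal (4 * weight_const\<^sup>2 * K powr ?r) *
      (indicator {0..1} y + ennreal (y powr (- q / 2)) * indicator {1..} y)"
    using True by (intro mult_left_mono) (auto simp: indicator_def)
  finally show ?thesis using True by simp
qed

lemma dominating_function_integrable:
  "(\<integral>\<^sup>+y. C * (indicator {0..1} y + ennreal (y powr (- q / 2)) * indicator {1..} y) \<partial>lborel) < \<infinity>"
  if "C < \<infinity>" for C :: ennreal
proof -
  have "((\<lambda>y. y powr (- q / 2)) has_integral - (1 powr (- q / 2 + 1)) / (- q / 2 + 1)) {1..}"
    using q by (intro has_integral_powr_to_inf) auto
  then have "(\<integral>\<^sup>+y\<in>{1..}. ennreal (y powr (- q / 2)) \<partial>lborel) =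
      ennreal (- (1 powr (- q / 2 + 1)) / (- q / 2 + 1))"
    by (intro nn_integral_has_integral_lebesgue') auto
  then have "(\<integral>\<^sup>+y. indicator {0..1} y + ennreal (y powr (- q / 2)) * indicator {1..} y \<partial>lborel) < \<infinity>"
    by (subst nn_integral_add) auto
  then show ?thesis
    using that by (subst nn_integral_cmult) (auto simp: ennreal_mult_less_top)
qed

end

section \<open>Continuity of the functional under a common power tail\<close>

lemma power_tail_cdf_limit_member:
  fixes Gs :: "nat \<Rightarrow> real \<Rightarrow> real"
  assumes seq: "\<And>n. power_tail_cdf q K x\<^sub>0 c (Gs n)"
    and lim: "\<And>x. (\<lambda>n. Gs n x) \<longlonglongrightarrow> G x"
  shows "power_tail_cdf q K x\<^sub>0 c G"
proof -
  note s = power_tail_cdf.mono[OF seq] power_tail_cdf.zero[OF seq] power_tail_cdf.le1[OF seq]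
    power_tail_cdf.tail[OF seq] power_tail_cdf.G_x\<^sub>0[OF seq]
  show ?thesis
  proof (rule power_tail_cdf.intro)
    show "mono G"
      using lim s(1) by (intro monoI LIMSEQ_le[OF lim lim]) (auto dest: monoD)
    show "G x = 0" if "x < 0" for x
      using lim[of x] s(2)[OF that] by (simp add: LIMSEQ_const_iff)
    show "G x \<le> 1" for x by (rule LIMSEQ_le_const2[OF lim]) (auto simp: s)
    show "G x\<^sub>0 \<le> c" by (rule LIMSEQ_le_const2[OF lim]) (auto simp: s)
    show "1 - G y \<le> K * y powr - q" if "0 < y" for y
      by (rule LIMSEQ_le_const2[OF tendsto_diff[OF tendsto_const lim]]) (auto simp: s that)
  qed (rule power_tail_cdf.q[OF seq[of 0]] power_tail_cdf.K[OF seq[of 0]]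
      power_tail_cdf.x\<^sub>0[OF seq[of 0]] power_tail_cdf.c[OF seq[of 0]])+
qed

locale power_tail_cdf_limit = power_tail_cdf q K x\<^sub>0 c G
  for q K x\<^sub>0 c :: real and G :: "real \<Rightarrow> real" +
  fixes Gs :: "nat \<Rightarrow> real \<Rightarrow> real"
  assumes seq: "\<And>n. power_tail_cdf q K x\<^sub>0 c (Gs n)"
    and lim: "\<And>x. (\<lambda>n. Gs n x) \<longlonglongrightarrow> G x"
begin

text \<open>
  By \<open>quantile_le\<close> and \<open>quantile_ge\<close>, a strict bound on the quantile at \<open>s\<close> corresponds to a strict
  bound on the distribution function at some point \<open>b\<close>, and this persists for large \<open>n\<close>.  For the
  upper bound, \<open>quantile G s < b\<close> by itself only gives \<open>s \<le> G b\<close>; continuity at \<open>s\<close> allows to pass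
  to a slightly larger level \<open>r\<close>, and \<open>s < r \<le> G b\<close>.
\<close>
lemma quantile_tendsto:
  assumes s: "0 < s" "s < 1" and cont: "isCont (quantile G) s"
  shows "(\<lambda>n. quantile (Gs n) s) \<longlonglongrightarrow> quantile G s"
proof (rule order_tendstoI)
  fix a assume "a < quantile G s"
  then obtain b where b: "a < b" "b < quantile G s" using dense by blast
  then have "G b < s" using quantile_le[OF s(1), of b] by force
  from order_tendstoD(2)[OF lim this]
  show "\<forall>\<^sub>F n in sequentially. a < quantile (Gs n) s"
  proof eventually_elim
    case (elim n)
    then show ?case using power_tail_cdf.quantile_ge[OF seq elim s(2)] b by simp
  qed
next
  fix a assume "quantile G s < a"
  then obtain b where b: "quantile G s < b" "b < a" using dense by blast
  have "\<forall>\<^sub>F r in at s. quantile G r < b"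
    using cont b(1) by (intro order_tendstoD) (auto simp: isCont_def)
  then have "\<forall>\<^sub>F r in at_right s. quantile G r < b"
    by (rule filter_leD[OF at_le, rotated]) auto
  moreover have "\<forall>\<^sub>F r in at_right s. r \<in> {s<..<1}"
    using s(2) by (rule eventually_at_right_real)
  ultimately have "\<forall>\<^sub>F r in at_right s. quantile G r < b \<and> r \<in> {s<..<1}"
    by eventually_elim auto
  then obtain r where r: "quantile G r < b" "s < r" "r < 1"
    using eventually_happens[of _ "at_right s"] by force
  then have "s < G b" using quantile_ge[of b r] by force
  from order_tendstoD(1)[OF lim this]
  show "\<forall>\<^sub>F n in sequentially. quantile (Gs n) s < a"
  proof eventually_elim
    case (elim n)
    then show ?case using power_tail_cdf.quantile_le[OF seq s(1), of n b] b by simp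
  qed
qed

lemma AE_quantile_tendsto:
  "AE s in lborel. s \<in> {0<..<1} \<longrightarrow> (\<lambda>n. quantile (Gs n) s) \<longlonglongrightarrow> quantile G s"
proof -
  have "countable {s\<in>{0<..<1}. \<not> isCont (quantile G) s}"
    by (rule mono_on_ctble_discont_open[OF _ quantile_mono]) simp
  then have "{s\<in>{0<..<1}. \<not> isCont (quantile G) s} \<in> null_sets lborel"
    by (rule countable_imp_null_set_lborel)
  from AE_not_in[OF this] show ?thesis
    by eventually_elim (use quantile_tendsto in auto)
qed

text \<open>
  The values at \<open>0\<close> and \<open>1\<close> are arbitrary, so the integrand is first cut off to the open
  interval, where the quantile function is monotone (hence measurable) and dominated.
\<close>
lemma quantile_integral_tendsto:
  assumes [measurable]: "S \<in> sets borel" and S: "S \<subseteq> {0..1}"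
  shows "(\<lambda>n. \<integral>\<^sup>+s\<in>S. ennreal (quantile (Gs n) s) \<partial>lborel)
    \<longlonglongrightarrow> (\<integral>\<^sup>+s\<in>S. ennreal (quantile G s) \<partial>lborel)"
proof -
  note [measurable] = measurable_quantile power_tail_cdf.measurable_quantile[OF seq]
  have eq: "(\<integral>\<^sup>+s\<in>S. ennreal (quantile H s) \<partial>lborel) =
      (\<integral>\<^sup>+s\<in>S. (ennreal (quantile H s) * indicator {0<..<1} s) \<partial>lborel)" for H
  proof (rule nn_integral_cong_AE)
    show "AE s in lborel. ennreal (quantile H s) * indicator S s =
        ennreal (quantile H s) * indicator {0<..<1} s * indicator S s"
      using AE_lborel_singleton[of 0] AE_lborel_singleton[of 1]
      by eventually_elim (use S in \<open>auto simp: indicator_def\<close>)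
  qed
  have "(\<lambda>n. \<integral>\<^sup>+s\<in>S. (ennreal (quantile (Gs n) s) * indicator {0<..<1} s) \<partial>lborel)
    \<longlonglongrightarrow> (\<integral>\<^sup>+s\<in>S. (ennreal (quantile G s) * indicator {0<..<1} s) \<partial>lborel)"
  proof (rule nn_integral_dominated_convergence)
    show "AE s in lborel. ennreal (quantile (Gs n) s) * indicator {0<..<1} s * indicator S s
        \<le> ennreal (K / sqrt (1 - s)) * indicator {0..1} s" for n
      by (rule AE_I2) (auto simp: indicator_def
          intro!: ennreal_leI power_tail_cdf.quantile_le_tail[OF seq])
    show "(\<integral>\<^sup>+s\<in>{0..1}. ennreal (K / sqrt (1 - s)) \<partial>lborel) < \<infinity>"
      using K by (subst nn_integral_inverse_sqrt) auto
    show "AE s in lborel. (\<lambda>n. ennreal (quantile (Gs n) s) * indicator {0<..<1} s * indicator S s)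
      \<longlonglongrightarrow> ennreal (quantile G s) * indicator {0<..<1} s * indicator S s"
      using AE_quantile_tendsto
      by eventually_elim (auto simp: indicator_def intro!: tendsto_ennrealI)
  qed measurable
  then show ?thesis by (simp only: eq[symmetric])
qed

lemma lower_L_tendsto: "p \<le> 1 \<Longrightarrow> (\<lambda>n. lower_L (Gs n) p) \<longlonglongrightarrow> lower_L G p"
  unfolding lower_L_def by (rule quantile_integral_tendsto) auto

lemma upper_M_tendsto: "p \<le> 1 \<Longrightarrow> (\<lambda>n. upper_M (Gs n) p) \<longlonglongrightarrow> upper_M G p"
  unfolding upper_M_def by (rule quantile_integral_tendsto) auto

lemma inverse_upper_M_tendsto:
  "p \<le> 1 \<Longrightarrow> (\<lambda>n. inverse (upper_M (Gs n) p)) \<longlonglongrightarrow> inverse (upper_M G p)"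
  by (rule continuous_on_tendsto_compose[OF continuous_on_inverse_ennreal[OF continuous_on_id[of UNIV]]
        upper_M_tendsto]) auto

lemma upper_M_pos: "0 < p \<Longrightarrow> p \<le> 1 \<Longrightarrow> 0 < upper_M G p"
  using upper_M_ge[of p] M_slope_pos by (auto simp: zero_less_iff_neq_zero)

text \<open>
  The argument moves with \<open>n\<close>, because the weight of \<open>Gs n\<close> is evaluated at \<open>Gs n x\<close>.  As \<open>ts n\<close>
  eventually exceeds \<open>t / 2\<close>, the integrands are eventually dominated by a constant.
\<close>
lemma weight1_tendsto:
  assumes t: "0 < t" "t < 1" and ts: "ts \<longlonglongrightarrow> t"
  shows "(\<lambda>n. weight1 (Gs n) (ts n)) \<longlonglongrightarrow> weight1 G t"
  unfolding weight1_def
proof (rule nn_integral_dominated_convergence_eventually)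
  have bound: "1 / upper_M (Gs n) s * indicator {ts n..1} s
      \<le> ennreal (1 / M_slope / (t / 2)) * indicator {0..1} s" if "t / 2 < ts n" for n s
  proof (cases "s \<in> {ts n..1}")
    case True
    then have s: "t / 2 \<le> s" "0 < s" "s \<le> 1" using that t by auto
    have "1 / upper_M (Gs n) s \<le> ennreal (1 / M_slope / s)"
      using s by (intro power_tail_cdf.inverse_upper_M_le[OF seq])
    also have "\<dots> \<le> ennreal (1 / M_slope / (t / 2))"
      using s t M_slope_pos by (intro ennreal_leI divide_left_mono) auto
    finally show ?thesis using True s by simp
  qed simp
  show "\<forall>\<^sub>F n in sequentially. AE s in lborel.
      1 / upper_M (Gs n) s * indicator {ts n..1} s \<le> ennreal (1 / M_slope / (t / 2)) * indicator {0..1} s"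
  proof (rule eventually_mono[OF order_tendstoD(1)[OF ts]])
    show "t / 2 < t" using t by simp
  qed (intro AE_I2 bound)
  show "AE s in lborel. (\<lambda>n. 1 / upper_M (Gs n) s * indicator {ts n..1} s)
      \<longlonglongrightarrow> 1 / upper_M G s * indicator {t..1} s"
    using AE_lborel_singleton[of t]
  proof eventually_elim
    case (elim s)
    have ev: "\<forall>\<^sub>F n in sequentially. (indicator {ts n..1} s :: ennreal) = indicator {t..1} s"
      using eventually_le_limit_iff[OF ts elim] by eventually_elim (auto simp: indicator_def)
    show ?case
    proof (cases "s \<in> {t..1}")
      case True
      have "(\<lambda>n. 1 / upper_M (Gs n) s) \<longlonglongrightarrow> 1 / upper_M G s"
        using inverse_upper_M_tendsto[of s] True by (simp add: divide_ennreal_def)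
      moreover have "\<forall>\<^sub>F n in sequentially. 1 / upper_M (Gs n) s = 1 / upper_M (Gs n) s * indicator {ts n..1} s"
        using ev by eventually_elim (use True in auto)
      ultimately show ?thesis using True by (auto dest: Lim_transform_eventually)
    next
      case False
      then show ?thesis using ev by (auto intro!: tendsto_eventually elim: eventually_mono)
    qed
  qed
qed (auto simp: nn_integral_cmult_indicator)

lemma weight2_tendsto:
  assumes t: "0 < t" "t < 1" and ts: "ts \<longlonglongrightarrow> t"
  shows "(\<lambda>n. weight2 (Gs n) (ts n)) \<longlonglongrightarrow> weight2 G t"
  unfolding weight2_def
proof (rule nn_integral_dominated_convergence_eventually)
  let ?C = "2 * K / M_slope\<^sup>2 / ((1 - t) / 2)"
  have bound: "lower_L (Gs n) (1 - s) / (upper_M (Gs n) (1 - s))\<^sup>2 * indicator {0..ts n} s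
      \<le> ennreal ?C * indicator {0..1} s" if "ts n < (1 + t) / 2" for n s
  proof (cases "s \<in> {0..ts n}")
    case True
    then have s: "(1 - t) / 2 \<le> 1 - s" "0 \<le> s" "s < 1"
      using that t by (auto simp: field_simps)
    have "lower_L (Gs n) (1 - s) / (upper_M (Gs n) (1 - s))\<^sup>2 \<le> ennreal (2 * K / M_slope\<^sup>2 / (1 - s))"
      using s by (intro power_tail_cdf.weight2_integrand_le[OF seq])
    also have "\<dots> \<le> ennreal ?C"
      using s t K by (intro ennreal_leI divide_left_mono) auto
    finally show ?thesis using True s by simp
  qed simp
  show "\<forall>\<^sub>F n in sequentially. AE s in lborel.
      lower_L (Gs n) (1 - s) / (upper_M (Gs n) (1 - s))\<^sup>2 * indicator {0..ts n} s
      \<le> ennreal ?C * indicator {0..1} s"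
  proof (rule eventually_mono[OF order_tendstoD(2)[OF ts]])
    show "t < (1 + t) / 2" using t by (simp add: field_simps)
  qed (intro AE_I2 bound)
  show "AE s in lborel.
      (\<lambda>n. lower_L (Gs n) (1 - s) / (upper_M (Gs n) (1 - s))\<^sup>2 * indicator {0..ts n} s)
      \<longlonglongrightarrow> lower_L G (1 - s) / (upper_M G (1 - s))\<^sup>2 * indicator {0..t} s"
    using AE_lborel_singleton[of t]
  proof eventually_elim
    case (elim s)
    have "\<forall>\<^sub>F n in sequentially. - ts n \<le> - s \<longleftrightarrow> - t \<le> - s"
      using tendsto_minus[OF ts] elim by (intro eventually_le_limit_iff) auto
    then have ev: "\<forall>\<^sub>F n in sequentially. (indicator {0..ts n} s :: ennreal) = indicator {0..t} s"
      by eventually_elim (auto simp: indicator_def)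
    show ?case
    proof (cases "s \<in> {0..t}")
      case True
      then have s: "0 < 1 - s" "1 - s \<le> 1" using t by auto
      have sq: "a / b\<^sup>2 = a * (inverse b * inverse b)" for a b :: ennreal
        by (simp add: divide_ennreal_def ennreal_inverse_power flip: power2_eq_square)
      have fin: "inverse (upper_M G (1 - s)) < \<infinity>"
        using upper_M_pos[OF s] by (simp add: less_top[symmetric] zero_less_iff_neq_zero)
      have "(\<lambda>n. lower_L (Gs n) (1 - s) * (inverse (upper_M (Gs n) (1 - s)) * inverse (upper_M (Gs n) (1 - s))))
        \<longlonglongrightarrow> lower_L G (1 - s) * (inverse (upper_M G (1 - s)) * inverse (upper_M G (1 - s)))"
        using s lower_L_le[of "1 - s"] fin
        by (intro tendsto_mult_ennreal inverse_upper_M_tendsto lower_L_tendsto)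
           (auto simp: ennreal_mult_eq_top_iff top_unique)
      then have "(\<lambda>n. lower_L (Gs n) (1 - s) / (upper_M (Gs n) (1 - s))\<^sup>2)
        \<longlonglongrightarrow> lower_L G (1 - s) / (upper_M G (1 - s))\<^sup>2"
        by (simp add: sq)
      moreover have "\<forall>\<^sub>F n in sequentially. lower_L (Gs n) (1 - s) / (upper_M (Gs n) (1 - s))\<^sup>2
         = lower_L (Gs n) (1 - s) / (upper_M (Gs n) (1 - s))\<^sup>2 * indicator {0..ts n} s"
        using ev by eventually_elim (use True in auto)
      ultimately show ?thesis using True by (auto dest: Lim_transform_eventually)
    next
      case False
      then show ?thesis using ev by (auto intro!: tendsto_eventually elim: eventually_mono)
    qed
  qed
qed (auto simp: nn_integral_cmult_indicator)

text \<open>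
  Where \<open>0 < G x\<close> and \<open>G y < 1\<close> all factors converge to finite limits.  Otherwise the limit is \<open>0\<close>,
  although the weights may tend to infinity, and the bound of \<open>pair_kernel_le\<close> squeezes the kernels.
\<close>
lemma pair_kernel_tendsto:
  assumes "x \<le> y"
  shows "(\<lambda>n. ennreal (Gs n x) * weight (Gs n) (Gs n x)
        * (ennreal (1 - Gs n y) * weight (Gs n) (Gs n y)))
    \<longlonglongrightarrow> ennreal (G x) * weight G (G x) * (ennreal (1 - G y) * weight G (G y))"
proof (cases "0 < G x \<and> G y < 1")
  case True
  have w: "(\<lambda>n. weight (Gs n) (Gs n z)) \<longlonglongrightarrow> weight G (G z)" "weight G (G z) < \<infinity>"
    if "x \<le> z" "z \<le> y" for z
  proof -
    have "0 < G z" "G z < 1"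
      using True monoD[OF mono that(1)] monoD[OF mono that(2)] by auto
    then show "(\<lambda>n. weight (Gs n) (Gs n z)) \<longlonglongrightarrow> weight G (G z)" "weight G (G z) < \<infinity>"
      unfolding weight_def[of "Gs _"] weight_def[of G "G z"]
      using weight_finite[of "G z"] by (auto intro!: tendsto_add weight1_tendsto weight2_tendsto lim simp: weight_def)
  qed
  show ?thesis
    using w[of x] w[of y] assms
    by (intro tendsto_mult_ennreal tendsto_ennrealI tendsto_diff tendsto_const lim)
       (auto simp: ennreal_mult_eq_top_iff)
next
  case False
  have r: "0 < 1 - 2 * \<eta>" using \<eta> by simp
  have z: "G x powr (1 - 2 * \<eta>) * (1 - G y) powr (1 - 2 * \<eta>) = 0"
    and z': "ennreal (G x) * weight G (G x) * (ennreal (1 - G y) * weight G (G y)) = 0"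
    using False nonneg[of x] le1[of y] by (auto simp: not_less le_less)
  have "(\<lambda>n. 4 * weight_const\<^sup>2 * Gs n x powr (1 - 2 * \<eta>) * (1 - Gs n y) powr (1 - 2 * \<eta>))
    \<longlonglongrightarrow> 4 * weight_const\<^sup>2 * G x powr (1 - 2 * \<eta>) * (1 - G y) powr (1 - 2 * \<eta>)"
    using r by (intro tendsto_mult tendsto_const tendsto_powr' tendsto_diff lim)
      (auto simp: power_tail_cdf.nonneg[OF seq] power_tail_cdf.le1[OF seq])
  then have "(\<lambda>n. ennreal (4 * weight_const\<^sup>2 * Gs n x powr (1 - 2 * \<eta>) * (1 - Gs n y) powr (1 - 2 * \<eta>)))
    \<longlonglongrightarrow> ennreal 0"
    using z by (intro tendsto_ennrealI) (simp add: mult.assoc)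
  then show ?thesis
    unfolding z' ennreal_0
    by (rule tendsto_sandwich[OF _ _ tendsto_const, rotated 2])
       (auto intro!: always_eventually power_tail_cdf.pair_kernel_le[OF seq] assms)
qed

lemma pair_integral_tendsto:
  assumes "0 \<le> y"
  shows "(\<lambda>n. \<integral>\<^sup>+x\<in>{0..y}. ennreal (Gs n x) * weight (Gs n) (Gs n x)
        * (ennreal (1 - Gs n y) * weight (Gs n) (Gs n y)) \<partial>lborel)
    \<longlonglongrightarrow> (\<integral>\<^sup>+x\<in>{0..y}. ennreal (G x) * weight G (G x)
        * (ennreal (1 - G y) * weight G (G y)) \<partial>lborel)"
proof (rule nn_integral_dominated_convergence)
  note [measurable] = measurable_G power_tail_cdf.measurable_G[OF seq]
  show "(\<lambda>x. ennreal (Gs n x) * weight (Gs n) (Gs n x)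
        * (ennreal (1 - Gs n y) * weight (Gs n) (Gs n y)) * indicator {0..y} x)
      \<in> borel_measurable lborel" for n
    by measurable
  show "(\<lambda>x. ennreal (G x) * weight G (G x)
        * (ennreal (1 - G y) * weight G (G y)) * indicator {0..y} x) \<in> borel_measurable lborel"
    by measurable
  show "(\<lambda>x. ennreal (4 * weight_const\<^sup>2) * indicator {0..y} x) \<in> borel_measurable lborel" by measurable
  show "AE x in lborel. ennreal (Gs n x) * weight (Gs n) (Gs n x)
        * (ennreal (1 - Gs n y) * weight (Gs n) (Gs n y)) * indicator {0..y} x
      \<le> ennreal (4 * weight_const\<^sup>2) * indicator {0..y} x" for n
  proof (rule AE_I2)
    fix x
    have "(1 - Gs n y) powr (1 - 2 * \<eta>) \<le> 1"
      using power_tail_cdf.nonneg[OF seq] power_tail_cdf.le1[OF seq] \<eta> by (intro powr_le1) auto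
    then have "ennreal (4 * weight_const\<^sup>2 * (1 - Gs n y) powr (1 - 2 * \<eta>)) \<le> ennreal (4 * weight_const\<^sup>2)"
      by (intro ennreal_leI mult_left_le) auto
    then show "ennreal (Gs n x) * weight (Gs n) (Gs n x)
        * (ennreal (1 - Gs n y) * weight (Gs n) (Gs n y)) * indicator {0..y} x
      \<le> ennreal (4 * weight_const\<^sup>2) * indicator {0..y} x"
      using power_tail_cdf.pair_kernel_le_tail[OF seq, of x y n]
      by (auto simp: indicator_def intro: order_trans)
  qed
  show "(\<integral>\<^sup>+x\<in>{0..y}. ennreal (4 * weight_const\<^sup>2) \<partial>lborel) < \<infinity>"
    using assms by (simp add: nn_integral_cmult_indicator ennreal_mult_less_top)
  show "AE x in lborel. (\<lambda>n. ennreal (Gs n x) * weight (Gs n) (Gs n x)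
        * (ennreal (1 - Gs n y) * weight (Gs n) (Gs n y)) * indicator {0..y} x)
      \<longlonglongrightarrow> ennreal (G x) * weight G (G x)
        * (ennreal (1 - G y) * weight G (G y)) * indicator {0..y} x"
    by (rule AE_I2) (auto simp: indicator_def intro!: pair_kernel_tendsto)
qed

end

context power_tail_cdf
begin

lemma pair_integral_eq:
  "(\<integral>\<^sup>+x\<in>{0..y}. ennreal (G x) * weight G (G x) * z \<partial>lborel)
    = (\<integral>\<^sup>+x\<in>{0..y}. ennreal (G x) * weight G (G x) \<partial>lborel) * z"
proof -
  have "(\<integral>\<^sup>+x\<in>{0..y}. ennreal (G x) * weight G (G x) * z \<partial>lborel)
    = (\<integral>\<^sup>+x. (ennreal (G x) * weight G (G x) * indicator {0..y} x) * z \<partial>lborel)"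
    by (intro nn_integral_cong) (simp add: mult_ac)
  also have "\<dots> = (\<integral>\<^sup>+x\<in>{0..y}. ennreal (G x) * weight G (G x) \<partial>lborel) * z"
    by (rule nn_integral_multc) measurable
  finally show ?thesis .
qed

lemma sigma_sq_eq_pair_integral:
  "sigma_sq G = (\<integral>\<^sup>+y\<in>{0..}. (\<integral>\<^sup>+x\<in>{0..y}. ennreal (G x) * weight G (G x)
        * (ennreal (1 - G y) * weight G (G y)) \<partial>lborel) \<partial>lborel)"
  unfolding sigma_sq_def pair_integral_eq ..

lemma measurable_pair_integral:
  "(\<lambda>y. (\<integral>\<^sup>+x\<in>{0..y}. ennreal (G x) * weight G (G x)
        * (ennreal (1 - G y) * weight G (G y)) \<partial>lborel) * indicator {0..} y)
    \<in> borel_measurable borel"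
proof -
  have "mono (\<lambda>y. \<integral>\<^sup>+x\<in>{0..y}. ennreal (G x) * weight G (G x) \<partial>lborel)"
    by (intro monoI nn_integral_mono) (auto simp: indicator_def)
  note [measurable] = borel_measurable_mono_ennreal[OF this]
  show ?thesis unfolding pair_integral_eq by measurable
qed

lemma sigma_sq_finite: "sigma_sq G < \<infinity>"
proof -
  have "sigma_sq G \<le> (\<integral>\<^sup>+y. ennreal (4 * weight_const\<^sup>2 * K powr (1 - 2 * \<eta>)) *
      (indicator {0..1} y + ennreal (y powr (- q / 2)) * indicator {1..} y) \<partial>lborel)"
    unfolding sigma_sq_eq_pair_integral by (intro nn_integral_mono inner_integral_le)
  also have "\<dots> < \<infinity>" by (rule dominating_function_integrable) simp
  finally show ?thesis .
qed

end

lemma (in power_tail_cdf_limit) sigma_sq_tendsto: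
  "(\<lambda>n. sigma_sq (Gs n)) \<longlonglongrightarrow> sigma_sq G"
  unfolding sigma_sq_eq_pair_integral power_tail_cdf.sigma_sq_eq_pair_integral[OF seq]
proof (rule nn_integral_dominated_convergence)
  let ?w = "\<lambda>y. ennreal (4 * weight_const\<^sup>2 * K powr (1 - 2 * \<eta>)) *
      (indicator {0..1} y + ennreal (y powr (- q / 2)) * indicator {1..} y)"
  show "AE y in lborel. (\<integral>\<^sup>+x\<in>{0..y}. ennreal (Gs n x) * weight (Gs n) (Gs n x)
        * (ennreal (1 - Gs n y) * weight (Gs n) (Gs n y)) \<partial>lborel) * indicator {0..} y \<le> ?w y" for n
    by (intro AE_I2 power_tail_cdf.inner_integral_le[OF seq])
  show "(\<integral>\<^sup>+y. ?w y \<partial>lborel) < \<infinity>" by (rule dominating_function_integrable) simp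
  show "AE y in lborel. (\<lambda>n. (\<integral>\<^sup>+x\<in>{0..y}. ennreal (Gs n x) * weight (Gs n) (Gs n x)
        * (ennreal (1 - Gs n y) * weight (Gs n) (Gs n y)) \<partial>lborel) * indicator {0..} y)
    \<longlonglongrightarrow> (\<integral>\<^sup>+x\<in>{0..y}. ennreal (G x) * weight G (G x)
        * (ennreal (1 - G y) * weight G (G y)) \<partial>lborel) * indicator {0..} y"
    by (intro AE_I2) (simp add: pair_integral_tendsto split: split_indicator)
qed (auto intro: measurable_pair_integral power_tail_cdf.measurable_pair_integral[OF seq])

text \<open>
  Pointwise convergence at \<open>x\<^sub>0\<close> alone provides, from some index on, a common level \<open>c < 1\<close>.
  Dropping finitely many indices also removes \<open>n = 0\<close>, for which no tail bound is assumed: the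
  empirical distribution function of an empty sample vanishes identically.
\<close>
theorem sigma_sq_tendsto_of_power_tail:
  fixes Gs :: "nat \<Rightarrow> real \<Rightarrow> real"
  assumes q: "2 < q" and K: "1 \<le> K"
    and mono: "\<And>n. mono (Gs n)"
    and zero: "\<And>n x. x < 0 \<Longrightarrow> Gs n x = 0"
    and le1: "\<And>n x. Gs n x \<le> 1"
    and tail: "\<And>n y. 0 < n \<Longrightarrow> 0 < y \<Longrightarrow> 1 - Gs n y \<le> K * y powr - q"
    and lim: "\<And>x. (\<lambda>n. Gs n x) \<longlonglongrightarrow> G x"
    and x\<^sub>0: "0 < x\<^sub>0" "G x\<^sub>0 < 1"
  shows "sigma_sq G < \<infinity>" and "(\<lambda>n. sigma_sq (Gs n)) \<longlonglongrightarrow> sigma_sq G"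
proof -
  obtain c where c: "G x\<^sub>0 < c" "c < 1" using dense[OF x\<^sub>0(2)] by blast
  have G_nonneg: "0 \<le> Gs n x" for n x
    using zero[of "min x (-1)"] monoD[OF mono, of "min x (-1)" x] by simp
  have "0 \<le> G x\<^sub>0" by (rule LIMSEQ_le_const[OF lim]) (auto simp: G_nonneg)
  with c have c0: "0 \<le> c" by simp
  obtain N where N: "\<And>n. n \<ge> N \<Longrightarrow> Gs n x\<^sub>0 < c"
    using order_tendstoD(2)[OF lim c(1)] by (auto simp: eventually_sequentially)
  define Hs where "Hs n = Gs (n + Suc N)" for n
  have seq: "power_tail_cdf q K x\<^sub>0 c (Hs n)" for n
    using q K mono zero le1 tail x\<^sub>0(1) c0 c(2) N[of "n + Suc N"]
    by (intro power_tail_cdf.intro) (auto simp: Hs_def less_imp_le)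
  have Hs_lim: "(\<lambda>n. Hs n x) \<longlonglongrightarrow> G x" for x
    unfolding Hs_def using lim by (rule LIMSEQ_ignore_initial_segment)
  interpret power_tail_cdf_limit q K x\<^sub>0 c G Hs
    using power_tail_cdf_limit_member[OF seq Hs_lim] seq Hs_lim
    by (intro power_tail_cdf_limit.intro power_tail_cdf_limit_axioms.intro)
  show "sigma_sq G < \<infinity>" by (rule sigma_sq_finite)
  have "(\<lambda>n. sigma_sq (Gs (n + Suc N))) \<longlonglongrightarrow> sigma_sq G"
    using sigma_sq_tendsto by (simp add: Hs_def)
  then show "(\<lambda>n. sigma_sq (Gs n)) \<longlonglongrightarrow> sigma_sq G" by (rule LIMSEQ_offset)
qed

section \<open>Averages of independent random variables\<close>

text \<open>
  For \<open>2 ^ k \<le> n < 2 ^ (k + 1)\<close> compare \<open>S n\<close> with \<open>S (2 ^ (k + 1))\<close>, which costs a factor \<open>2\<close>; the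
  indices below the threshold go into the constant.
\<close>
lemma linear_bound_of_dyadic:
  fixes S :: "nat \<Rightarrow> real"
  assumes mono: "mono S" and S0: "S 0 = 0" and D: "0 \<le> D"
    and dyadic: "\<forall>\<^sub>F k in sequentially. S (2 ^ k) \<le> D * 2 ^ k"
  obtains B where "\<And>n. S n \<le> B * real n"
proof -
  obtain k\<^sub>0 where k\<^sub>0: "\<And>k. k \<ge> k\<^sub>0 \<Longrightarrow> S (2 ^ k) \<le> D * 2 ^ k"
    using dyadic by (auto simp: eventually_sequentially)
  have S_nonneg: "0 \<le> S n" for n using monoD[OF mono, of 0 n] S0 by simp
  define B where "B = S (2 ^ k\<^sub>0) + 2 * D"
  have "S n \<le> B * real n" for n
  proof (cases "n = 0")
    case True
    then show ?thesis using S0 by simp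
  next
    case n0: False
    show ?thesis
    proof (cases "n \<le> 2 ^ k\<^sub>0")
      case True
      have "S n \<le> S (2 ^ k\<^sub>0)" by (rule monoD[OF mono True])
      also have "\<dots> \<le> S (2 ^ k\<^sub>0) * real n"
        using mult_left_mono[of 1 "real n", OF _ S_nonneg] n0 by simp
      also have "\<dots> \<le> B * real n" using D by (intro mult_right_mono) (auto simp: B_def)
      finally show ?thesis .
    next
      case False
      obtain k where k: "2 ^ k \<le> n" "n < 2 ^ (k + 1)"
        using ex_power_ivl1[of 2 n] n0 by auto
      have "k\<^sub>0 < k + 1"
        by (rule power_less_imp_less_exp[of "2 :: nat"]) (use False k in auto)
      then have "S n \<le> D * 2 ^ (k + 1)"
        using monoD[OF mono, of n "2 ^ (k + 1)"] k k\<^sub>0[of "k + 1"] by simp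
      also have "\<dots> = 2 * D * real (2 ^ k)" by simp
      also have "\<dots> \<le> 2 * D * real n" using k D by (intro mult_left_mono) auto
      also have "\<dots> \<le> B * real n" using S_nonneg by (intro mult_right_mono) (auto simp: B_def)
      finally show ?thesis .
    qed
  qed
  then show ?thesis by (rule that)
qed

context prob_space
begin

text \<open>
  Centred independent variables are orthogonal, so their second moments add.
\<close>
lemma
  fixes Z :: "'i \<Rightarrow> 'a \<Rightarrow> real"
  assumes "finite I" "indep_vars (\<lambda>_. borel) Z I"
    and "\<And>i. i \<in> I \<Longrightarrow> integrable M (\<lambda>\<xi>. (Z i \<xi>)\<^sup>2)"
    and "\<And>i. i \<in> I \<Longrightarrow> expectation (Z i) = 0"
  shows integrable_square_indep_sum: "integrable M (\<lambda>\<xi>. (\<Sum>i\<in>I. Z i \<xi>)\<^sup>2)"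
    and expectation_square_indep_sum:
      "expectation (\<lambda>\<xi>. (\<Sum>i\<in>I. Z i \<xi>)\<^sup>2) = (\<Sum>i\<in>I. expectation (\<lambda>\<xi>. (Z i \<xi>)\<^sup>2))"
proof -
  have "integrable M (\<lambda>\<xi>. (\<Sum>i\<in>I. Z i \<xi>)\<^sup>2) \<and>
      expectation (\<lambda>\<xi>. (\<Sum>i\<in>I. Z i \<xi>)\<^sup>2) = (\<Sum>i\<in>I. expectation (\<lambda>\<xi>. (Z i \<xi>)\<^sup>2))"
    using assms
  proof (induction I rule: finite_induct)
    case empty
    then show ?case by simp
  next
    case (insert j I)
    have rv: "random_variable borel (Z i)" if "i \<in> insert j I" for i
      using insert.prems(1) that unfolding indep_vars_def by blast
    have int: "integrable M (Z i)" if "i \<in> insert j I" for i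
      using rv[OF that] insert.prems(2)[OF that] by (rule square_integrable_imp_integrable)
    have IH: "integrable M (\<lambda>\<xi>. (\<Sum>i\<in>I. Z i \<xi>)\<^sup>2)"
      "expectation (\<lambda>\<xi>. (\<Sum>i\<in>I. Z i \<xi>)\<^sup>2) = (\<Sum>i\<in>I. expectation (\<lambda>\<xi>. (Z i \<xi>)\<^sup>2))"
      using insert.IH insert.prems indep_vars_subset[OF insert.prems(1)] by auto
    have ind: "indep_var borel (Z j) borel (\<lambda>\<xi>. \<Sum>i\<in>I. Z i \<xi>)"
      using insert.hyps insert.prems(1) by (intro indep_vars_sum)
    have intS: "integrable M (\<lambda>\<xi>. \<Sum>i\<in>I. Z i \<xi>)" using int by auto
    have cross: "integrable M (\<lambda>\<xi>. Z j \<xi> * (\<Sum>i\<in>I. Z i \<xi>))"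
      "expectation (\<lambda>\<xi>. Z j \<xi> * (\<Sum>i\<in>I. Z i \<xi>)) = 0"
      using indep_var_integrable[OF ind int intS] indep_var_lebesgue_integral[OF ind int intS]
        insert.prems(3)[of j] by auto
    have eq: "(\<Sum>i\<in>insert j I. Z i \<xi>)\<^sup>2 =
        (Z j \<xi>)\<^sup>2 + (\<Sum>i\<in>I. Z i \<xi>)\<^sup>2 + 2 * (Z j \<xi> * (\<Sum>i\<in>I. Z i \<xi>))" for \<xi>
      using insert.hyps by (simp add: power2_sum)
    show ?case
      unfolding eq using insert.hyps insert.prems(2)[of j] IH cross by simp
  qed
  then show "integrable M (\<lambda>\<xi>. (\<Sum>i\<in>I. Z i \<xi>)\<^sup>2)"
    "expectation (\<lambda>\<xi>. (\<Sum>i\<in>I. Z i \<xi>)\<^sup>2) = (\<Sum>i\<in>I. expectation (\<lambda>\<xi>. (Z i \<xi>)\<^sup>2))"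
    by auto
qed

text \<open>
  Truncation at the level \<open>N\<close>: a moment of order \<open>1 + d\<close> bounds by \<open>C * N powr - d\<close> both the
  probability that some \<open>Y i\<close> reaches \<open>N\<close> (Markov and the union bound) and the probability that
  the truncated sum exceeds its mean by \<open>N\<close> (Chebyshev).
\<close>
lemma prob_large_indep_sum_le:
  fixes Y :: "nat \<Rightarrow> 'a \<Rightarrow> real"
  assumes indep: "indep_vars (\<lambda>_. borel) Y UNIV"
    and nonneg: "\<And>i \<xi>. 0 \<le> Y i \<xi>"
    and d: "0 < d" "d \<le> 1"
    and int: "\<And>i. integrable M (\<lambda>\<xi>. Y i \<xi> powr (1 + d))"
    and C: "\<And>i. expectation (\<lambda>\<xi>. Y i \<xi> powr (1 + d)) \<le> C"
    and N: "0 < N"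
  shows "prob {\<xi>\<in>space M. (C + 2) * real N < (\<Sum>i<N. Y i \<xi>)} \<le> 2 * C * real N powr - d"
proof -
  have [measurable]: "random_variable borel (Y i)" for i
    using indep unfolding indep_vars_def by blast
  let ?N = "real N"
  have N1: "1 \<le> ?N" using N by simp
  define Z where "Z i \<xi> = min (Y i \<xi>) ?N" for i \<xi>
  have [measurable]: "random_variable borel (Z i)" for i unfolding Z_def by measurable
  have Z_bounds: "0 \<le> Z i \<xi>" "Z i \<xi> \<le> ?N" for i \<xi> using nonneg by (auto simp: Z_def)
  have Z_int: "integrable M (Z i)" for i
    using Z_bounds by (intro integrable_const_bound[of _ ?N]) auto
  have Z_sq: "(Z i \<xi>)\<^sup>2 \<le> ?N powr (1 - d) * Y i \<xi> powr (1 + d)" for i \<xi>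
  proof (cases "Y i \<xi> = 0")
    case True
    then show ?thesis by (simp add: Z_def)
  next
    case False
    then have "0 < Z i \<xi>" using nonneg[of i \<xi>] N by (auto simp: Z_def)
    then have "(Z i \<xi>)\<^sup>2 = Z i \<xi> powr (1 - d) * Z i \<xi> powr (1 + d)"
      by (simp flip: powr_add add: powr_numeral)
    also have "\<dots> \<le> ?N powr (1 - d) * Y i \<xi> powr (1 + d)"
      using Z_bounds[of i \<xi>] d by (intro mult_mono powr_mono2) (auto simp: Z_def)
    finally show ?thesis .
  qed
  have Z_sq_int: "integrable M (\<lambda>\<xi>. (Z i \<xi>)\<^sup>2)" for i
    using Z_bounds by (intro integrable_const_bound[of _ "?N\<^sup>2"]) (auto intro!: power_mono)
  have EZ: "expectation (Z i) \<le> 1 + C" for i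
  proof -
    have "Z i \<xi> \<le> 1 + Y i \<xi> powr (1 + d)" for \<xi>
    proof (cases "Y i \<xi> \<le> 1")
      case False
      then have "Y i \<xi> powr 1 \<le> Y i \<xi> powr (1 + d)" using d by (intro powr_mono) auto
      then show ?thesis using False by (simp add: Z_def)
    qed (simp add: Z_def add_increasing2)
    then have "expectation (Z i) \<le> expectation (\<lambda>\<xi>. 1 + Y i \<xi> powr (1 + d))"
      using Z_int int by (intro integral_mono) auto
    also have "\<dots> \<le> 1 + C" using C[of i] int by (simp add: prob_space)
    finally show ?thesis .
  qed
  define W where "W i \<xi> = Z i \<xi> - expectation (Z i)" for i \<xi>
  have W_indep: "indep_vars (\<lambda>_. borel) W {..<N}"
    unfolding W_def Z_def
    using indep_vars_compose2[OF indep_vars_subset[OF indep], of "{..<N}"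
        "\<lambda>i y. min y ?N - expectation (\<lambda>\<xi>. min (Y i \<xi>) ?N)" "\<lambda>_. borel"] by simp
  have W_sq_int: "integrable M (\<lambda>\<xi>. (W i \<xi>)\<^sup>2)" for i
    unfolding W_def power2_diff using Z_int Z_sq_int by auto
  have W_mean: "expectation (W i) = 0" for i
    unfolding W_def using Z_int by (simp add: prob_space)
  have W_sq: "expectation (\<lambda>\<xi>. (W i \<xi>)\<^sup>2) \<le> ?N powr (1 - d) * C" for i
  proof -
    have "expectation (\<lambda>\<xi>. (W i \<xi>)\<^sup>2) = expectation (\<lambda>\<xi>. (Z i \<xi>)\<^sup>2) - (expectation (Z i))\<^sup>2"
      unfolding W_def by (rule variance_eq[OF Z_int Z_sq_int])
    also have "\<dots> \<le> expectation (\<lambda>\<xi>. (Z i \<xi>)\<^sup>2)" by simp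
    also have "\<dots> \<le> expectation (\<lambda>\<xi>. ?N powr (1 - d) * Y i \<xi> powr (1 + d))"
      using Z_sq_int int Z_sq by (intro integral_mono) auto
    also have "\<dots> \<le> ?N powr (1 - d) * C" using C[of i] by (simp add: mult_left_mono)
    finally show ?thesis .
  qed
  have powr_eq: "?N * ?N powr (1 - d) / ?N\<^sup>2 = ?N powr - d" "?N / ?N powr (1 + d) = ?N powr - d"
    using N1 by (auto simp: powr_diff powr_add powr_minus power2_eq_square divide_simps)
  have A: "prob {\<xi>\<in>space M. ?N\<^sup>2 \<le> (\<Sum>i<N. W i \<xi>)\<^sup>2} \<le> C * ?N powr - d"
  proof -
    have "prob {\<xi>\<in>space M. ?N\<^sup>2 \<le> (\<Sum>i<N. W i \<xi>)\<^sup>2} \<le> expectation (\<lambda>\<xi>. (\<Sum>i<N. W i \<xi>)\<^sup>2) / ?N\<^sup>2"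
      using N1 by (intro integral_Markov_inequality_measure[where A = "space M"]
          integrable_square_indep_sum W_indep W_sq_int W_mean) auto
    also have "expectation (\<lambda>\<xi>. (\<Sum>i<N. W i \<xi>)\<^sup>2) = (\<Sum>i<N. expectation (\<lambda>\<xi>. (W i \<xi>)\<^sup>2))"
      by (intro expectation_square_indep_sum W_indep W_sq_int W_mean) auto
    also have "\<dots> \<le> ?N * (?N powr (1 - d) * C)"
      using sum_bounded_above[of "{..<N}", OF W_sq] by simp
    also have "?N * (?N powr (1 - d) * C) / ?N\<^sup>2 = C * (?N * ?N powr (1 - d) / ?N\<^sup>2)" by simp
    finally show ?thesis unfolding powr_eq by (simp add: divide_right_mono)
  qed
  have B: "prob (\<Union>i<N. {\<xi>\<in>space M. ?N powr (1 + d) \<le> Y i \<xi> powr (1 + d)}) \<le> C * ?N powr - d"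
  proof -
    have "prob (\<Union>i<N. {\<xi>\<in>space M. ?N powr (1 + d) \<le> Y i \<xi> powr (1 + d)})
      \<le> (\<Sum>i<N. prob {\<xi>\<in>space M. ?N powr (1 + d) \<le> Y i \<xi> powr (1 + d)})"
      by (rule finite_measure_subadditive_finite) auto
    also have "\<dots> \<le> ?N * (C / ?N powr (1 + d))"
    proof (rule sum_bounded_above[of "{..<N}", simplified])
      fix i
      have "prob {\<xi>\<in>space M. ?N powr (1 + d) \<le> Y i \<xi> powr (1 + d)}
        \<le> expectation (\<lambda>\<xi>. Y i \<xi> powr (1 + d)) / ?N powr (1 + d)"
        using N1 int by (intro integral_Markov_inequality_measure[where A = "space M"]) auto
      also have "\<dots> \<le> C / ?N powr (1 + d)" using C by (intro divide_right_mono) auto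
      finally show "prob {\<xi>\<in>space M. ?N powr (1 + d) \<le> Y i \<xi> powr (1 + d)} \<le> C / ?N powr (1 + d)" .
    qed
    also have "?N * (C / ?N powr (1 + d)) = C * (?N / ?N powr (1 + d))" by simp
    finally show ?thesis unfolding powr_eq .
  qed
  have "{\<xi>\<in>space M. (C + 2) * ?N < (\<Sum>i<N. Y i \<xi>)} \<subseteq>
      {\<xi>\<in>space M. ?N\<^sup>2 \<le> (\<Sum>i<N. W i \<xi>)\<^sup>2} \<union>
      (\<Union>i<N. {\<xi>\<in>space M. ?N powr (1 + d) \<le> Y i \<xi> powr (1 + d)})" (is "?E \<subseteq> ?E1 \<union> ?E2")
  proof
    fix \<xi> assume \<xi>: "\<xi> \<in> ?E"
    show "\<xi> \<in> ?E1 \<union> ?E2"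
    proof (cases "\<exists>i<N. ?N \<le> Y i \<xi>")
      case True
      then show ?thesis using \<xi> d by (auto intro!: powr_mono2)
    next
      case False
      then have "Y i \<xi> = Z i \<xi>" if "i < N" for i using that by (auto simp: Z_def not_le)
      then have "(\<Sum>i<N. Y i \<xi>) = (\<Sum>i<N. W i \<xi>) + (\<Sum>i<N. expectation (Z i))"
        by (simp add: W_def flip: sum.distrib)
      moreover have "(\<Sum>i<N. expectation (Z i)) \<le> ?N * (1 + C)"
        using sum_bounded_above[of "{..<N}", OF EZ] by simp
      ultimately have "?N \<le> (\<Sum>i<N. W i \<xi>)" using \<xi> by (simp add: algebra_simps)
      then show ?thesis using \<xi> by (auto intro!: power_mono)
    qed
  qed
  then have "prob ?E \<le> prob (?E1 \<union> ?E2)" by (intro finite_measure_mono) (auto simp: W_def)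
  also have "\<dots> \<le> prob ?E1 + prob ?E2"
    by (intro measure_Un_le) (auto simp: W_def)
  finally show ?thesis using A B by simp
qed

text \<open>
  The probabilities of \<open>prob_large_indep_sum_le\<close> are summable along \<open>N = 2 ^ k\<close>, so by
  Borel--Cantelli the dyadic averages are almost surely bounded; the spare moment of order \<open>d\<close>
  makes the series geometric.
\<close>
lemma AE_indep_sums_linearly_bounded:
  fixes Y :: "nat \<Rightarrow> 'a \<Rightarrow> real"
  assumes indep: "indep_vars (\<lambda>_. borel) Y UNIV"
    and nonneg: "\<And>i \<xi>. 0 \<le> Y i \<xi>"
    and d: "0 < d" "d \<le> 1"
    and int: "\<And>i. integrable M (\<lambda>\<xi>. Y i \<xi> powr (1 + d))"
    and C: "\<And>i. expectation (\<lambda>\<xi>. Y i \<xi> powr (1 + d)) \<le> C"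
  shows "AE \<xi> in M. \<exists>B. \<forall>n. (\<Sum>i<n. Y i \<xi>) \<le> B * real n"
proof -
  have [measurable]: "random_variable borel (Y i)" for i
    using indep unfolding indep_vars_def by blast
  have C0: "0 \<le> C" by (rule order_trans[OF Bochner_Integration.integral_nonneg C[of 0]]) simp
  let ?A = "\<lambda>k::nat. {\<xi>\<in>space M. (C + 2) * real (2 ^ k) < (\<Sum>i<2 ^ k. Y i \<xi>)}"
  have bound: "prob (?A k) \<le> 2 * C * (2 powr - d) ^ k" for k
  proof -
    have "real (2 ^ k) powr - d = (2 powr real k) powr - d"
      by (simp add: powr_realpow)
    also have "\<dots> = (2 powr - d) powr real k"
      unfolding powr_powr by (simp only: mult.commute)
    also have "\<dots> = (2 powr - d) ^ k"
      by (simp add: powr_realpow)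
    finally show ?thesis
      using prob_large_indep_sum_le[OF indep nonneg d int C, of "2 ^ k"] by simp
  qed
  have "summable (\<lambda>k. 2 * C * (2 powr - d) ^ k)"
    using d by (intro summable_mult summable_geometric) (auto simp: powr_less_one)
  then have "summable (\<lambda>k. prob (?A k))"
    by (rule summable_comparison_test[rotated]) (use bound in auto)
  then have "AE \<xi> in M. eventually (\<lambda>k. \<xi> \<in> space M - ?A k) sequentially"
    by (intro borel_cantelli_AE1) (auto simp: emeasure_eq_measure)
  then show ?thesis
  proof eventually_elim
    case (elim \<xi>)
    then have "\<forall>\<^sub>F k in sequentially. (\<Sum>i<2 ^ k. Y i \<xi>) \<le> (C + 2) * 2 ^ k"
      by eventually_elim auto
    then obtain B where "\<And>n. (\<Sum>i<n. Y i \<xi>) \<le> B * real n"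
      by (rule linear_bound_of_dyadic[rotated 3])
         (use C0 nonneg in \<open>auto intro!: monoI sum_mono2\<close>)
    then show ?case by blast
  qed
qed

text \<open>
  For bounded variables Hoeffding's inequality gives exponentially small, hence summable,
  probabilities of a deviation.
\<close>
lemma AE_average_tendsto_of_bounded_iid:
  fixes Z :: "nat \<Rightarrow> 'a \<Rightarrow> real"
  assumes indep: "indep_vars (\<lambda>_. borel) Z UNIV"
    and distr: "\<And>i. distr M borel (Z i) = distr M borel Y"
    and [measurable]: "random_variable borel Y" and Y: "\<And>\<xi>. \<xi> \<in> space M \<Longrightarrow> 0 \<le> Y \<xi> \<and> Y \<xi> \<le> 1"
  shows "AE \<xi> in M. (\<lambda>n. (\<Sum>i<n. Z i \<xi>) / real n) \<longlonglongrightarrow> expectation Y"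
proof -
  have [measurable]: "random_variable borel (Z i)" for i
    using indep unfolding indep_vars_def by blast
  have "AE \<xi> in M. \<forall>\<^sub>F n in sequentially. \<bar>(\<Sum>i<n. Z i \<xi>) / real n - expectation Y\<bar> < \<epsilon>"
    if \<epsilon>: "0 < \<epsilon>" for \<epsilon> :: real
  proof -
    let ?A = "\<lambda>n. {\<xi>\<in>space M. \<bar>(\<Sum>i<n. Z i \<xi>) / real n - expectation Y\<bar> \<ge> \<epsilon>}"
    have bound: "prob (?A n) \<le> 2 * exp (- 2 * \<epsilon>\<^sup>2) ^ n" for n
    proof (cases "n = 0")
      case True
      then show ?thesis using order_trans[OF prob_le_1[of "?A n"], of 2] by simp
    next
      case False
      interpret H: Hoeffding_ineq_iid M "{..<n}" Z Y 0 1 "expectation Y"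
        using distr Y indep_vars_subset[OF indep, of "{..<n}"]
        by unfold_locales (auto intro!: AE_I2)
      have "prob (?A n) \<le> 2 * exp (- 2 * real n * \<epsilon>\<^sup>2)"
        using H.Hoeffding_ineq_abs_ge'[of \<epsilon>] \<epsilon> False by auto
      also have "exp (- 2 * real n * \<epsilon>\<^sup>2) = exp (- 2 * \<epsilon>\<^sup>2) ^ n"
        by (simp add: exp_of_nat_mult[symmetric] mult_ac)
      finally show ?thesis .
    qed
    have "summable (\<lambda>n. 2 * exp (- 2 * \<epsilon>\<^sup>2) ^ n)"
      using \<epsilon> by (intro summable_mult summable_geometric) auto
    then have "summable (\<lambda>n. prob (?A n))"
      by (rule summable_comparison_test[rotated]) (use bound in auto)
    then have "AE \<xi> in M. eventually (\<lambda>n. \<xi> \<in> space M - ?A n) sequentially"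
      by (intro borel_cantelli_AE1) (auto simp: emeasure_eq_measure)
    then show ?thesis by eventually_elim (auto elim: eventually_mono)
  qed
  then have "AE \<xi> in M. \<forall>k. \<forall>\<^sub>F n in sequentially.
      \<bar>(\<Sum>i<n. Z i \<xi>) / real n - expectation Y\<bar> < inverse (real (Suc k))"
    unfolding AE_all_countable by simp
  then show ?thesis
  proof eventually_elim
    case (elim \<xi>)
    show ?case
    proof (rule tendstoI)
      fix e :: real assume "0 < e"
      then obtain k where "inverse (real (Suc k)) < e" using reals_Archimedean by blast
      then show "\<forall>\<^sub>F n in sequentially. dist ((\<Sum>i<n. Z i \<xi>) / real n) (expectation Y) < e"
        using spec[OF elim, of k] by (auto simp: dist_real_def elim: eventually_mono)
    qed
  qed
qed

end

text \<open>
  This turns almost sure convergence at each rational point into one exceptional null set for all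
  points.
\<close>
lemma tendsto_of_rational_tendsto:
  fixes Fs :: "nat \<Rightarrow> real \<Rightarrow> real"
  assumes mono: "\<And>n. mono (Fs n)" and cont: "isCont F x"
    and rat: "\<And>r. r \<in> \<rat> \<Longrightarrow> (\<lambda>n. Fs n r) \<longlonglongrightarrow> F r"
  shows "(\<lambda>n. Fs n x) \<longlonglongrightarrow> F x"
proof (rule order_tendstoI)
  fix a assume "a < F x"
  then have "\<forall>\<^sub>F r in at_left x. a < F r"
    using cont by (intro order_tendstoD(1)) (auto simp: isCont_def filterlim_at_split)
  then obtain b where b: "b < x" "\<And>r. b < r \<Longrightarrow> r < x \<Longrightarrow> a < F r"
    unfolding eventually_at_left_field by blast
  obtain r where r: "r \<in> \<rat>" "b < r" "r < x" using Rats_dense_in_real[OF b(1)] by blast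
  have "\<forall>\<^sub>F n in sequentially. a < Fs n r"
    using order_tendstoD(1)[OF rat[OF r(1)]] b r by blast
  then show "\<forall>\<^sub>F n in sequentially. a < Fs n x"
    by eventually_elim (use monoD[OF mono, of r x] r in \<open>auto intro: less_le_trans\<close>)
next
  fix a assume "F x < a"
  then have "\<forall>\<^sub>F r in at_right x. F r < a"
    using cont by (intro order_tendstoD(2)) (auto simp: isCont_def filterlim_at_split)
  then obtain b where b: "x < b" "\<And>r. x < r \<Longrightarrow> r < b \<Longrightarrow> F r < a"
    unfolding eventually_at_right_field by blast
  obtain r where r: "r \<in> \<rat>" "x < r" "r < b" using Rats_dense_in_real[OF b(1)] by blast
  have "\<forall>\<^sub>F n in sequentially. Fs n r < a"
    using order_tendstoD(2)[OF rat[OF r(1)]] b r by blast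
  then show "\<forall>\<^sub>F n in sequentially. Fs n x < a"
    by eventually_elim (use monoD[OF mono, of x r] r in \<open>auto intro: le_less_trans\<close>)
qed

section \<open>Empirical distribution functions\<close>

lemma mono_empirical_cdf: "mono (empirical_cdf X n)"
  unfolding empirical_cdf_def
  by (intro monoI mult_left_mono sum_mono) (auto simp: indicator_def)

lemma empirical_cdf_negative: "x < 0 \<Longrightarrow> empirical_cdf X n x = 0"
  by (simp add: empirical_cdf_def indicator_def)

lemma empirical_cdf_le_1: "empirical_cdf X n x \<le> 1"
proof -
  have "(\<Sum>i<n. indicator {0..x} (X i) :: real) \<le> real n"
    using sum_bounded_above[of "{..<n}" "\<lambda>i. indicator {0..x} (X i) :: real" 1]
    by (simp add: indicator_def)
  then show ?thesis by (cases "n = 0") (auto simp: empirical_cdf_def)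
qed

text \<open>
  Markov's inequality for the empirical measure.
\<close>
lemma empirical_cdf_tail:
  assumes X: "\<And>i. 0 \<le> X i" and q: "0 < q" and n: "0 < n" and y: "0 < y"
    and B: "(\<Sum>i<n. \<bar>X i\<bar> powr q) \<le> B * real n"
  shows "1 - empirical_cdf X n y \<le> B * y powr - q"
proof -
  have *: "1 - indicator {0..y} (X i) \<le> \<bar>X i\<bar> powr q * y powr - q" for i
  proof (cases "X i \<le> y")
    case True
    then show ?thesis using X[of i] by simp
  next
    case False
    then have "y powr q \<le> \<bar>X i\<bar> powr q" using y q by (intro powr_mono2) auto
    then show ?thesis using False y by (simp add: powr_minus divide_simps)
  qed
  have "real n - (\<Sum>i<n. indicator {0..y} (X i)) = (\<Sum>i<n. 1 - indicator {0..y} (X i))"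
    by (simp add: sum_subtractf)
  also have "\<dots> \<le> (\<Sum>i<n. \<bar>X i\<bar> powr q * y powr - q)" by (intro sum_mono *)
  also have "\<dots> = (\<Sum>i<n. \<bar>X i\<bar> powr q) * y powr - q" by (simp add: sum_distrib_right)
  also have "\<dots> \<le> B * real n * y powr - q" using B by (intro mult_right_mono) auto
  finally show ?thesis using n by (simp add: empirical_cdf_def field_simps)
qed

section \<open>Almost sure convergence of the empirical functional\<close>

theorem theorem3p4:
  fixes P :: "'a measure" and X :: "'a \<Rightarrow> real" and Xs :: "nat \<Rightarrow> 'a \<Rightarrow> real"
    and F :: "real \<Rightarrow> real" and \<delta> :: real
  assumes prob: "prob_space P"
    and X_rv: "X \<in> borel_measurable P"
    and X_nonneg: "AE \<xi> in P. 0 \<le> X \<xi>"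
    and F_def: "F = cdf (distr P borel X)"
    and F_cont: "continuous_on UNIV F"
    and Xs_indep: "prob_space.indep_vars P (\<lambda>_. borel) Xs UNIV"
    and Xs_distr: "\<And>i. distr P borel (Xs i) = distr P borel X"
    and delta_pos: "\<delta> > 0"
    and moment: "integrable P (\<lambda>\<xi>. \<bar>X \<xi>\<bar> powr (2 + \<delta>))"
  shows "sigma_sq F < \<infinity> \<and>
    (AE \<xi> in P. (\<lambda>n. sigma_sq (empirical_cdf (\<lambda>i. Xs i \<xi>) n)) \<longlonglongrightarrow> sigma_sq F)"
proof -
  interpret prob_space P by (rule prob)
  note [measurable] = X_rv
  have Xs_rv [measurable]: "random_variable borel (Xs i)" for i
    using Xs_indep unfolding indep_vars_def by blast
  have F_prob: "F x = prob {\<xi>\<in>space P. X \<xi> \<le> x}" for x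
    unfolding F_def cdf_def by (subst measure_distr) (auto intro!: arg_cong[of _ _ prob])
  have F_Icc: "F x = expectation (\<lambda>\<xi>. indicator {0..x} (X \<xi>))" for x
  proof -
    have "F x = prob {\<xi>\<in>space P. X \<xi> \<in> {0..x}}"
      unfolding F_prob by (rule finite_measure_eq_AE) (use X_nonneg in \<open>auto elim!: eventually_mono\<close>)
    also have "\<dots> = expectation (indicator {\<xi>\<in>space P. X \<xi> \<in> {0..x}})" by simp
    also have "\<dots> = expectation (\<lambda>\<xi>. indicator {0..x} (X \<xi>))"
      by (intro Bochner_Integration.integral_cong) (auto simp: indicator_def)
    finally show ?thesis .
  qed

  \<comment> \<open>Continuity excludes an atom at \<open>0\<close>, so \<open>F x\<^sub>0 < 1\<close> for some \<open>x\<^sub>0 > 0\<close>.\<close>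
  have F_neg: "F x = 0" if "x < 0" for x
    using that by (simp add: F_Icc)
  have F_isCont: "isCont F x" for x using F_cont by (simp add: continuous_on_eq_continuous_at)
  have "F 0 = 0"
  proof (rule tendsto_unique)
    show "(F \<longlongrightarrow> F 0) (at_left 0)" using F_isCont[of 0] by (auto simp: isCont_def filterlim_at_split)
    have "\<forall>\<^sub>F x in at_left (0::real). F x = 0"
      unfolding eventually_at_left_field by (intro exI[of _ "-1"]) (auto simp: F_neg)
    then show "(F \<longlongrightarrow> 0) (at_left 0)" by (rule tendsto_eventually)
  qed simp
  then have "\<forall>\<^sub>F x in at_right 0. F x < 1"
    using F_isCont[of 0] by (intro order_tendstoD(2)) (auto simp: isCont_def filterlim_at_split)
  then obtain b where b: "0 < b" "\<And>x. 0 < x \<Longrightarrow> x < b \<Longrightarrow> F x < 1"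
    unfolding eventually_at_right_field by blast
  obtain x\<^sub>0 where x\<^sub>0: "0 < x\<^sub>0" "F x\<^sub>0 < 1" using b(2) dense[OF b(1)] by blast

  \<comment> \<open>Half of the spare moment goes into the tail exponent \<open>q > 2\<close>, the other half into the
    moment of order \<open>1 + d\<close> of \<open>\<bar>Xs i\<bar> powr q\<close>.\<close>
  define q where "q = 2 + \<delta> / 2"
  define d where "d = (2 + \<delta>) / q - 1"
  have q: "2 < q" "0 < d" "d \<le> 1" "q * (1 + d) = 2 + \<delta>"
    using delta_pos by (auto simp: q_def d_def field_simps)
  have Xs_moment: "integrable P (\<lambda>\<xi>. \<bar>Xs i \<xi>\<bar> powr (2 + \<delta>))"
    "expectation (\<lambda>\<xi>. \<bar>Xs i \<xi>\<bar> powr (2 + \<delta>)) = expectation (\<lambda>\<xi>. \<bar>X \<xi>\<bar> powr (2 + \<delta>))" for i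
  proof -
    have "integrable (distr P borel (Xs i)) (\<lambda>x. \<bar>x\<bar> powr (2 + \<delta>))"
      unfolding Xs_distr using moment by (subst integrable_distr_eq) auto
    then show "integrable P (\<lambda>\<xi>. \<bar>Xs i \<xi>\<bar> powr (2 + \<delta>))"
      by (subst (asm) integrable_distr_eq) auto
    have "expectation (\<lambda>\<xi>. \<bar>Xs i \<xi>\<bar> powr (2 + \<delta>)) =
        integral\<^sup>L (distr P borel (Xs i)) (\<lambda>x. \<bar>x\<bar> powr (2 + \<delta>))"
      by (subst integral_distr) auto
    also have "\<dots> = expectation (\<lambda>\<xi>. \<bar>X \<xi>\<bar> powr (2 + \<delta>))"
      unfolding Xs_distr by (subst integral_distr) auto
    finally show "expectation (\<lambda>\<xi>. \<bar>Xs i \<xi>\<bar> powr (2 + \<delta>)) = expectation (\<lambda>\<xi>. \<bar>X \<xi>\<bar> powr (2 + \<delta>))" .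
  qed
  have powr_q: "(\<bar>x\<bar> powr q) powr (1 + d) = \<bar>x\<bar> powr (2 + \<delta>)" for x :: real
    by (simp only: powr_powr q(4))
  have bounded: "AE \<xi> in P. \<exists>B. \<forall>n. (\<Sum>i<n. \<bar>Xs i \<xi>\<bar> powr q) \<le> B * real n"
  proof (rule AE_indep_sums_linearly_bounded[OF _ _ q(2,3)])
    show "indep_vars (\<lambda>_. borel) (\<lambda>i \<xi>. \<bar>Xs i \<xi>\<bar> powr q) UNIV"
      by (rule indep_vars_compose2[OF Xs_indep]) auto
    show "integrable P (\<lambda>\<xi>. (\<bar>Xs i \<xi>\<bar> powr q) powr (1 + d))" for i
      unfolding powr_q by (rule Xs_moment)
    show "expectation (\<lambda>\<xi>. (\<bar>Xs i \<xi>\<bar> powr q) powr (1 + d))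
        \<le> expectation (\<lambda>\<xi>. \<bar>X \<xi>\<bar> powr (2 + \<delta>))" for i
      unfolding powr_q by (simp only: Xs_moment order_refl)
  qed simp

  have "AE \<xi> in P. (\<lambda>n. empirical_cdf (\<lambda>i. Xs i \<xi>) n x) \<longlonglongrightarrow> F x" for x
  proof -
    have "AE \<xi> in P. (\<lambda>n. (\<Sum>i<n. indicator {0..x} (Xs i \<xi>)) / real n)
        \<longlonglongrightarrow> expectation (\<lambda>\<xi>. indicator {0..x} (X \<xi>))"
    proof (rule AE_average_tendsto_of_bounded_iid)
      show "indep_vars (\<lambda>_. borel) (\<lambda>i \<xi>. indicator {0..x} (Xs i \<xi>) :: real) UNIV"
        by (rule indep_vars_compose2[OF Xs_indep]) auto
      show "distr P borel (\<lambda>\<xi>. indicator {0..x} (Xs i \<xi>) :: real) =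
          distr P borel (\<lambda>\<xi>. indicator {0..x} (X \<xi>))" for i
        using arg_cong[OF Xs_distr[of i], of "\<lambda>\<mu>. distr \<mu> borel (indicator {0..x} :: real \<Rightarrow> real)"]
        by (simp add: distr_distr comp_def)
    qed auto
    then show ?thesis by (simp add: empirical_cdf_def F_Icc)
  qed
  then have rational: "AE \<xi> in P. \<forall>x\<in>\<rat>. (\<lambda>n. empirical_cdf (\<lambda>i. Xs i \<xi>) n x) \<longlonglongrightarrow> F x"
    by (intro AE_ball_countable[THEN iffD2] countable_rat) auto

  have "AE \<xi> in P. 0 \<le> Xs i \<xi>" for i
  proof -
    have "AE x in distr P borel (Xs i). 0 \<le> x"
      unfolding Xs_distr using X_nonneg by (subst AE_distr_iff) auto
    then show ?thesis by (subst (asm) AE_distr_iff) auto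
  qed
  then have "AE \<xi> in P. \<forall>i. 0 \<le> Xs i \<xi>" by (simp add: AE_all_countable)
  with bounded rational
  have *: "AE \<xi> in P. sigma_sq F < \<infinity> \<and>
    (\<lambda>n. sigma_sq (empirical_cdf (\<lambda>i. Xs i \<xi>) n)) \<longlonglongrightarrow> sigma_sq F"
  proof eventually_elim
    case (elim \<xi>)
    let ?Fs = "empirical_cdf (\<lambda>i. Xs i \<xi>)"
    from elim obtain B where B: "\<And>n. (\<Sum>i<n. \<bar>Xs i \<xi>\<bar> powr q) \<le> B * real n" by blast
    have tail: "1 - ?Fs n y \<le> max 1 B * y powr - q" if "0 < n" "0 < y" for n y
    proof -
      have "1 - ?Fs n y \<le> B * y powr - q"
        using elim that q B by (intro empirical_cdf_tail) auto
      also have "\<dots> \<le> max 1 B * y powr - q" by (intro mult_right_mono) auto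
      finally show ?thesis .
    qed
    have lim: "(\<lambda>n. ?Fs n x) \<longlonglongrightarrow> F x" for x
      by (rule tendsto_of_rational_tendsto[OF mono_empirical_cdf F_isCont bspec[OF elim(2)]])
    show ?case
      using sigma_sq_tendsto_of_power_tail[OF q(1) max.cobounded1 mono_empirical_cdf
          empirical_cdf_negative empirical_cdf_le_1 tail lim x\<^sub>0] by (rule conjI)
  qed
  \<comment> \<open>Finiteness of \<open>sigma_sq F\<close> was obtained on a set of full measure, but it is not random.\<close>
  then show ?thesis unfolding AE_conj_iff by simp
qed

end
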